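(* Let $\mathcal V$ be a braided rigid monoidal category and $\mathcal C$ a closed $\mathcal V$-monoidal category. For all $a\in\mathcal C$ and $u\in\mathcal V$, the $\mathcal V$-functor $(a\blacktriangleleft u)\otimes-:\overline{\mathcal C}\to\overline{\mathcal C}$ is left $\mathcal V$-adjoint to the $\mathcal V$-functor $[a\blacktriangleleft u,-]:\overline{\mathcal C}\to\overline{\mathcal C}$ via the isomorphisms $$\overline\theta_{b\blacktriangleleft v,c\blacktriangleleft w}:=\mathrm{id}_{v^*}\big[(\beta_{\mathcal C(ab\to c),u^*})^{-1}\circ(\theta_{b,c}\,\mathrm{id}_{u^*})\big]\mathrm{id}_w\in\mathcal V\big(v^*u^*\mathcal C(ab\to c)w\to v^*\mathcal C(b\to[a,c])u^*w\big)$$ $$=\mathcal V\big(\overline{\mathcal C}((a\blacktriangleleft u)(b\blacktriangleleft v)\to c\blacktriangleleft w)\to\overline{\mathcal C}(b\blacktriangleleft v\to[a\blacktriangleleft u,c\blacktriangleleft w])\big),$$ where $\theta_{b,c}:\mathcal C(ab\to c)\to\mathcal C(b\to[a,c])$ is the isomorphism of the $\mathcal V$-adjunction $(a\otimes-)\dashv_{\mathcal V}[a,-]$. Thus $\overline{\mathcal C}$ is closed.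
   Context: Conventions: composition is written left to right; tensor products in $\mathcal V$ are juxtaposition; associators and unitors are suppressed; $\beta_{u,v}:uv\to vu$ is the braiding, so $(\beta_{X,u})^{-1}:uX\to Xu$. Rigid: every object $v$ has a dual $v^*$ with $\mathrm{ev}_v:vv^*\to1_{\mathcal V}$, $\mathrm{coev}_v:1_{\mathcal V}\to v^*v$ satisfying the zig-zag relations (and is itself such a dual); duals are chosen with $(uv)^*=v^*u^*$. Then $\mathcal V$ is closed with $\widehat{\mathcal V}(u\to v)=u^*v$ where $\mathcal V(uw\to v)\cong\mathcal V(w\to\widehat{\mathcal V}(u\to v))$. A $\mathcal V$-category $\mathcal C$ has hom objects $\mathcal C(a\to b)\in\mathcal V$, identities $j_a:1_{\mathcal V}\to\mathcal C(a\to a)$ and composition $-\circ_{\mathcal C}-:\mathcal C(a\to b)\mathcal C(b\to c)\to\mathcal C(a\to c)$, associative and unital; a $\mathcal V$-functor $F$ has morphisms $F_{a\to b}:\mathcal C(a\to b)\to\mathcal D(F(a)\to F(b))$ compatible with composition and identities. $L\dashv_{\mathcal V}R$ via $\theta$ ($L:\mathcal C\to\mathcal D$, $R:\mathcal D\to\mathcal C$) means $\theta_{a,d}:\mathcal D(L(a)\to d)\to\mathcal C(a\to R(d))$ are isomorphisms in $\mathcal V$ with $(-\circ_{\mathcal C}-)\circ\theta^{-1}_{a,d}=(L_{a\to b}\theta_{b,d}^{-1})\circ(-\circ_{\mathcal D}-)$ on $\mathcal C(a\to b)\mathcal C(b\to R(d))$ and $(-\circ_{\mathcal D}-)\circ\theta_{a,d}=(\theta_{a,c}R_{c\to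 d})\circ(-\circ_{\mathcal C}-)$ on $\mathcal D(L(a)\to c)\mathcal D(c\to d)$. A (strict) $\mathcal V$-monoidal category is a $\mathcal V$-category $\mathcal C$ with a unit object $1_{\mathcal C}$, a strictly associative and unital product $ab$ of objects, and morphisms $-\otimes_{\mathcal C}-:\mathcal C(a\to b)\mathcal C(c\to d)\to\mathcal C(ac\to bd)$ that are associative, unital ($j_{1_{\mathcal C}}$ is a two-sided unit and $(j_aj_b)\circ(-\otimes_{\mathcal C}-)=j_{ab}$), and satisfy braided interchange: on $\mathcal C(a\to b)\mathcal C(d\to e)\mathcal C(b\to c)\mathcal C(e\to f)$, $((-\otimes_{\mathcal C}-)(-\otimes_{\mathcal C}-))\circ(-\circ_{\mathcal C}-)=(\mathrm{id}\,\beta_{\mathcal C(d\to e),\mathcal C(b\to c)}\,\mathrm{id})\circ((-\circ_{\mathcal C}-)(-\circ_{\mathcal C}-))\circ(-\otimes_{\mathcal C}-)$. It is closed if each $\mathcal V$-functor $a\otimes-:b\mapsto ab$, $(a\otimes-)_{b\to c}=(j_a\mathrm{id})\circ(-\otimes_{\mathcal C}-)$, has a right $\mathcal V$-adjoint $[a,-]$. Completion (for $\mathcal V$ rigid): $\overline{\mathcal C}$ has objects formal symbols $a\blacktriangleleft u$ ($a\in\mathcal C$, $u\in\mathcal V$); $\overline{\mathcal C}(a\blacktriangleleft u\to b\blacktriangleleft v)=u^*\mathcal C(a\to b)v$; $j_{a\blacktriangleleft u}=\mathrm{coev}_u\circ(\mathrm{id}_{u^*}j_a\mathrm{id}_u)$;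 composition $u^*\mathcal C(a\to b)vv^*\mathcal C(b\to c)w\to u^*\mathcal C(a\to c)w$ is $(\mathrm{id}\,\mathrm{ev}_v\,\mathrm{id})\circ(\mathrm{id}_{u^*}(-\circ_{\mathcal C}-)\mathrm{id}_w)$; $1_{\overline{\mathcal C}}=1_{\mathcal C}\blacktriangleleft1_{\mathcal V}$; $(a\blacktriangleleft u)(b\blacktriangleleft v)=ab\blacktriangleleft uv$; and $-\otimes_{\overline{\mathcal C}}-:u^*\mathcal C(a\to c)w\,v^*\mathcal C(b\to d)x\to v^*u^*\mathcal C(ab\to cd)wx$ is $((\beta_{v^*,u^*\mathcal C(a\to c)w})^{-1}\mathrm{id}_{\mathcal C(b\to d)x})\circ(\mathrm{id}_{v^*u^*\mathcal C(a\to c)}(\beta_{\mathcal C(b\to d),w})^{-1}\mathrm{id}_x)\circ(\mathrm{id}_{v^*u^*}(-\otimes_{\mathcal C}-)\mathrm{id}_{wx})$. The $\mathcal V$-functor $(a\blacktriangleleft u)\otimes-:\overline{\mathcal C}\to\overline{\mathcal C}$ is $b\blacktriangleleft v\mapsto(a\blacktriangleleft u)(b\blacktriangleleft v)=ab\blacktriangleleft uv$ on objects, and on hom objects is $((a\blacktriangleleft u)\otimes-)_{b\blacktriangleleft v\to c\blacktriangleleft w}=(j_{a\blacktriangleleft u}\,\mathrm{id}_{\overline{\mathcal C}(b\blacktriangleleft v\to c\blacktriangleleft w)})\circ(-\otimes_{\overline{\mathcal C}}-):\overline{\mathcal C}(b\blacktriangleleft v\to c\blacktriangleleft w)\to\overline{\mathcal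 C}(ab\blacktriangleleft uv\to ac\blacktriangleleft uw)$. The $\mathcal V$-functor $[a\blacktriangleleft u,-]$ is $b\blacktriangleleft v\mapsto[a,b]\blacktriangleleft u^*v$ on objects, and on hom objects is the composite $v^*\mathcal C(b\to c)w\to v^*\mathcal C([a,b]\to[a,c])w\to v^*u^{**}u^*\mathcal C([a,b]\to[a,c])w\to v^*u^{**}\mathcal C([a,b]\to[a,c])u^*w$ of $\mathrm{id}_{v^*}[a,-]_{b\to c}\mathrm{id}_w$, then $\mathrm{coev}_{u^*}$ inserted after $v^*$, then $\mathrm{id}\,(\beta_{\mathcal C([a,b]\to[a,c]),u^*})^{-1}\,\mathrm{id}_w$. *)

theory Defs
  imports Main
begin

section \<open>Braided rigid monoidal categories\<close>

text \<open>
  Objects form a type \<open>'o\<close> and arrows form a type \<open>'m\<close> on which source and target are total;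
  only composition is partial, and \<open>f \<Zsemi> g\<close> (first \<open>f\<close>, then \<open>g\<close>) is left unspecified unless the
  target of \<open>f\<close> is the source of \<open>g\<close>. Suppressing associators and unitors is rendered by a strict
  monoidal structure: \<open>\<odot>\<close> is the tensor product of objects, \<open>\<otimes>\<close> that of arrows, and
  \<open>\<langle>u\<rangle>\<close> is the identity of \<open>u\<close>.
\<close>

record ('o, 'm) monoidal_data =
  src :: "'m \<Rightarrow> 'o"
  tgt :: "'m \<Rightarrow> 'o"
  ident :: "'o \<Rightarrow> 'm" ("\<langle>_\<rangle>\<index>")
  arr_comp :: "'m \<Rightarrow> 'm \<Rightarrow> 'm" (infixl "\<Zsemi>\<index>" 60)
  tensor_obj :: "'o \<Rightarrow> 'o \<Rightarrow> 'o" (infixr "\<odot>\<index>" 75)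
  tensor_arr :: "'m \<Rightarrow> 'm \<Rightarrow> 'm" (infixr "\<otimes>\<index>" 70)
  unit_obj :: 'o ("\<I>\<index>")

record ('o, 'm) braided_data = "('o, 'm) monoidal_data" +
  braid :: "'o \<Rightarrow> 'o \<Rightarrow> 'm" ("\<beta>\<index>")

record ('o, 'm) rigid_data = "('o, 'm) braided_data" +
  dual :: "'o \<Rightarrow> 'o" ("_\<^sup>\<star>\<index>" [1000] 999)
  ev :: "'o \<Rightarrow> 'm"
  coev :: "'o \<Rightarrow> 'm"

definition hom :: "('o, 'm, 'z) monoidal_data_scheme \<Rightarrow> 'o \<Rightarrow> 'o \<Rightarrow> 'm set" where
  "hom V u v = {f. src V f = u \<and> tgt V f = v}"

definition inverse_arrows :: "('o, 'm, 'z) monoidal_data_scheme \<Rightarrow> 'm \<Rightarrow> 'm \<Rightarrow> bool" where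
  "inverse_arrows V f g \<longleftrightarrow> src V g = tgt V f \<and> tgt V g = src V f \<and>
     arr_comp V f g = ident V (src V f) \<and> arr_comp V g f = ident V (tgt V f)"

definition is_iso :: "('o, 'm, 'z) monoidal_data_scheme \<Rightarrow> 'm \<Rightarrow> bool" where
  "is_iso V f \<longleftrightarrow> (\<exists>g. inverse_arrows V f g)"

definition arr_inv :: "('o, 'm, 'z) monoidal_data_scheme \<Rightarrow> 'm \<Rightarrow> 'm" where
  "arr_inv V f = (THE g. inverse_arrows V f g)"

context
  fixes V :: "('o, 'm, 'z) monoidal_data_scheme" (structure)
begin

definition is_dual :: "'o \<Rightarrow> 'o \<Rightarrow> 'm \<Rightarrow> 'm \<Rightarrow> bool" where
  "is_dual v v' e c \<longleftrightarrow>
     e \<in> hom V (v \<odot> v') \<I> \<and> c \<in> hom V \<I> (v' \<odot> v) \<and>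
     (\<langle>v\<rangle> \<otimes> c) \<Zsemi> (e \<otimes> \<langle>v\<rangle>) = \<langle>v\<rangle> \<and>
     (c \<otimes> \<langle>v'\<rangle>) \<Zsemi> (\<langle>v'\<rangle> \<otimes> e) = \<langle>v'\<rangle>"

end

locale strict_monoidal_category =
  fixes V :: "('o, 'm, 'z) monoidal_data_scheme" (structure)
  assumes ident_hom: "\<langle>u\<rangle> \<in> hom V u u"
    and comp_hom: "\<lbrakk>f \<in> hom V u v; g \<in> hom V v w\<rbrakk> \<Longrightarrow> f \<Zsemi> g \<in> hom V u w"
    and comp_ident_left: "f \<in> hom V u v \<Longrightarrow> \<langle>u\<rangle> \<Zsemi> f = f"
    and comp_ident_right: "f \<in> hom V u v \<Longrightarrow> f \<Zsemi> \<langle>v\<rangle> = f"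
    and comp_assoc: "\<lbrakk>f \<in> hom V u v; g \<in> hom V v w; h \<in> hom V w x\<rbrakk> \<Longrightarrow>
      (f \<Zsemi> g) \<Zsemi> h = f \<Zsemi> (g \<Zsemi> h)"
    and tensor_hom: "\<lbrakk>f \<in> hom V u v; g \<in> hom V w x\<rbrakk> \<Longrightarrow> f \<otimes> g \<in> hom V (u \<odot> w) (v \<odot> x)"
    and tensor_ident: "\<langle>u\<rangle> \<otimes> \<langle>v\<rangle> = \<langle>u \<odot> v\<rangle>"
    and tensor_comp: "\<lbrakk>f \<in> hom V u v; g \<in> hom V v w; h \<in> hom V x y; k \<in> hom V y z\<rbrakk> \<Longrightarrow>
      (f \<Zsemi> g) \<otimes> (h \<Zsemi> k) = (f \<otimes> h) \<Zsemi> (g \<otimes> k)"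
    and tensor_obj_assoc: "(u \<odot> v) \<odot> w = u \<odot> (v \<odot> w)"
    and tensor_arr_assoc: "(f \<otimes> g) \<otimes> h = f \<otimes> (g \<otimes> h)"
    and unit_obj_left: "\<I> \<odot> u = u"
    and unit_obj_right: "u \<odot> \<I> = u"
    and unit_arr_left: "\<langle>\<I>\<rangle> \<otimes> f = f"
    and unit_arr_right: "f \<otimes> \<langle>\<I>\<rangle> = f"

locale braided_monoidal_category = strict_monoidal_category V
  for V :: "('o, 'm, 'z) braided_data_scheme" (structure) +
  assumes braid_hom: "\<beta> u v \<in> hom V (u \<odot> v) (v \<odot> u)"
    and braid_iso: "is_iso V (\<beta> u v)"
    and braid_natural: "\<lbrakk>f \<in> hom V u u'; g \<in> hom V v v'\<rbrakk> \<Longrightarrow>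
      (f \<otimes> g) \<Zsemi> \<beta> u' v' = \<beta> u v \<Zsemi> (g \<otimes> f)"
    and hexagon_left: "\<beta> (u \<odot> v) w = (\<langle>u\<rangle> \<otimes> \<beta> v w) \<Zsemi> (\<beta> u w \<otimes> \<langle>v\<rangle>)"
    and hexagon_right: "\<beta> u (v \<odot> w) = (\<beta> u v \<otimes> \<langle>w\<rangle>) \<Zsemi> (\<langle>v\<rangle> \<otimes> \<beta> u w)"

text \<open>
  \<open>dual_tensor\<close>, \<open>ev_tensor\<close> and \<open>coev_tensor\<close> together say that the chosen dual of \<open>uv\<close> is \<open>v\<^sup>\<star>u\<^sup>\<star>\<close> as a
  dual, that is, with the evaluation and coevaluation nested from those of \<open>u\<close> and \<open>v\<close>.
\<close>

locale braided_rigid_category = braided_monoidal_category V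
  for V :: "('o, 'm, 'z) rigid_data_scheme" (structure) +
  assumes dual_is_dual: "is_dual V v (v\<^sup>\<star>) (ev V v) (coev V v)"
    and is_itself_dual: "\<exists>w e c. is_dual V w v e c"
    and dual_tensor: "(u \<odot> v)\<^sup>\<star> = v\<^sup>\<star> \<odot> u\<^sup>\<star>"
    and ev_tensor: "ev V (u \<odot> v) = (\<langle>u\<rangle> \<otimes> ev V v \<otimes> \<langle>u\<^sup>\<star>\<rangle>) \<Zsemi> ev V u"
    and coev_tensor: "coev V (u \<odot> v) = coev V v \<Zsemi> (\<langle>v\<^sup>\<star>\<rangle> \<otimes> coev V u \<otimes> \<langle>v\<rangle>)"


section \<open>Enriched categories, functors and adjunctions\<close>

text \<open>
  For a \<open>V\<close>-category \<open>C\<close>: \<open>hom_obj C a b\<close> is the hom object \<open>C(a \<rightarrow> b)\<close>, and \<open>v_comp C a b c\<close> is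
  composition \<open>C(a \<rightarrow> b) C(b \<rightarrow> c) \<rightarrow> C(a \<rightarrow> c)\<close>.
\<close>

record ('c, 'o, 'm) v_category_data =
  hom_obj :: "'c \<Rightarrow> 'c \<Rightarrow> 'o"
  v_ident :: "'c \<Rightarrow> 'm"
  v_comp :: "'c \<Rightarrow> 'c \<Rightarrow> 'c \<Rightarrow> 'm"

locale v_category = strict_monoidal_category V
  for V :: "('o, 'm, 'z) monoidal_data_scheme" (structure) +
  fixes C :: "('c, 'o, 'm, 'y) v_category_data_scheme"
  assumes v_ident_hom: "v_ident C a \<in> hom V \<I> (hom_obj C a a)"
    and v_comp_hom: "v_comp C a b c \<in> hom V (hom_obj C a b \<odot> hom_obj C b c) (hom_obj C a c)"
    and v_comp_assoc:
      "(v_comp C a b c \<otimes> \<langle>hom_obj C c d\<rangle>) \<Zsemi> v_comp C a c d =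
       (\<langle>hom_obj C a b\<rangle> \<otimes> v_comp C b c d) \<Zsemi> v_comp C a b d"
    and v_ident_left: "(v_ident C a \<otimes> \<langle>hom_obj C a b\<rangle>) \<Zsemi> v_comp C a a b = \<langle>hom_obj C a b\<rangle>"
    and v_ident_right: "(\<langle>hom_obj C a b\<rangle> \<otimes> v_ident C b) \<Zsemi> v_comp C a b b = \<langle>hom_obj C a b\<rangle>"

record ('c, 'd, 'm) v_functor_data =
  f_obj :: "'c \<Rightarrow> 'd"
  f_hom :: "'c \<Rightarrow> 'c \<Rightarrow> 'm"

locale v_functor = C: v_category V C + D: v_category V D
  for V :: "('o, 'm, 'z) monoidal_data_scheme" (structure)
    and C :: "('c, 'o, 'm, 'y) v_category_data_scheme"
    and D :: "('d, 'o, 'm, 'x) v_category_data_scheme" +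
  fixes F :: "('c, 'd, 'm) v_functor_data"
  assumes f_hom_hom:
      "f_hom F a b \<in> hom V (hom_obj C a b) (hom_obj D (f_obj F a) (f_obj F b))"
    and f_hom_comp:
      "v_comp C a b c \<Zsemi> f_hom F a c =
       (f_hom F a b \<otimes> f_hom F b c) \<Zsemi> v_comp D (f_obj F a) (f_obj F b) (f_obj F c)"
    and f_hom_ident: "v_ident C a \<Zsemi> f_hom F a a = v_ident D (f_obj F a)"

locale v_adjunction = L: v_functor V C D L + R: v_functor V D C R
  for V :: "('o, 'm, 'z) monoidal_data_scheme" (structure)
    and C :: "('c, 'o, 'm, 'y) v_category_data_scheme"
    and D :: "('d, 'o, 'm, 'x) v_category_data_scheme"
    and L :: "('c, 'd, 'm) v_functor_data"
    and R :: "('d, 'c, 'm) v_functor_data" +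
  fixes \<theta> :: "'c \<Rightarrow> 'd \<Rightarrow> 'm"
  assumes theta_hom: "\<theta> a d \<in> hom V (hom_obj D (f_obj L a) d) (hom_obj C a (f_obj R d))"
    and theta_iso: "is_iso V (\<theta> a d)"
    and theta_natural_left:
      "v_comp C a b (f_obj R d) \<Zsemi> arr_inv V (\<theta> a d) =
       (f_hom L a b \<otimes> arr_inv V (\<theta> b d)) \<Zsemi> v_comp D (f_obj L a) (f_obj L b) d"
    and theta_natural_right:
      "v_comp D (f_obj L a) c d \<Zsemi> \<theta> a d =
       (\<theta> a c \<otimes> f_hom R c d) \<Zsemi> v_comp C a (f_obj R c) (f_obj R d)"


section \<open>Monoidal enriched categories\<close>

text \<open>\<open>v_tensor C a b c d\<close> is the tensor product \<open>C(a \<rightarrow> b) C(c \<rightarrow> d) \<rightarrow> C(ac \<rightarrow> bd)\<close>.\<close>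

record ('c, 'o, 'm) v_monoidal_data = "('c, 'o, 'm) v_category_data" +
  v_unit :: 'c
  v_prod :: "'c \<Rightarrow> 'c \<Rightarrow> 'c"
  v_tensor :: "'c \<Rightarrow> 'c \<Rightarrow> 'c \<Rightarrow> 'c \<Rightarrow> 'm"

locale v_monoidal_category = braided_monoidal_category V + v_category V C
  for V :: "('o, 'm, 'z) braided_data_scheme" (structure)
    and C :: "('c, 'o, 'm, 'y) v_monoidal_data_scheme" +
  assumes v_prod_assoc: "v_prod C (v_prod C a b) c = v_prod C a (v_prod C b c)"
    and v_unit_left: "v_prod C (v_unit C) a = a"
    and v_unit_right: "v_prod C a (v_unit C) = a"
    and v_tensor_hom:
      "v_tensor C a b c d \<in>
         hom V (hom_obj C a b \<odot> hom_obj C c d) (hom_obj C (v_prod C a c) (v_prod C b d))"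
    and v_tensor_assoc:
      "(v_tensor C a b c d \<otimes> \<langle>hom_obj C e f\<rangle>) \<Zsemi> v_tensor C (v_prod C a c) (v_prod C b d) e f =
       (\<langle>hom_obj C a b\<rangle> \<otimes> v_tensor C c d e f) \<Zsemi> v_tensor C a b (v_prod C c e) (v_prod C d f)"
    and v_tensor_unit_left:
      "(v_ident C (v_unit C) \<otimes> \<langle>hom_obj C a b\<rangle>) \<Zsemi> v_tensor C (v_unit C) (v_unit C) a b =
       \<langle>hom_obj C a b\<rangle>"
    and v_tensor_unit_right:
      "(\<langle>hom_obj C a b\<rangle> \<otimes> v_ident C (v_unit C)) \<Zsemi> v_tensor C a b (v_unit C) (v_unit C) =
       \<langle>hom_obj C a b\<rangle>"
    and v_tensor_ident:
      "(v_ident C a \<otimes> v_ident C b) \<Zsemi> v_tensor C a a b b = v_ident C (v_prod C a b)"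
    and braided_interchange:
      "(v_tensor C a b d e \<otimes> v_tensor C b c e f) \<Zsemi>
         v_comp C (v_prod C a d) (v_prod C b e) (v_prod C c f) =
       (\<langle>hom_obj C a b\<rangle> \<otimes> \<beta> (hom_obj C d e) (hom_obj C b c) \<otimes> \<langle>hom_obj C e f\<rangle>) \<Zsemi>
         (v_comp C a b c \<otimes> v_comp C d e f) \<Zsemi> v_tensor C a c d f"

context
  fixes V :: "('o, 'm, 'z) monoidal_data_scheme" (structure)
begin

definition tensor_left ::
  "('c, 'o, 'm, 'y) v_monoidal_data_scheme \<Rightarrow> 'c
    \<Rightarrow> ('c, 'c, 'm) v_functor_data" where
  "tensor_left C a =
     \<lparr>f_obj = v_prod C a,
      f_hom = (\<lambda>b c. (v_ident C a \<otimes> \<langle>hom_obj C b c\<rangle>) \<Zsemi> v_tensor C a a b c)\<rparr>"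

end

locale closed_v_monoidal_category = v_monoidal_category V C
  for V :: "('o, 'm, 'z) braided_data_scheme" (structure)
    and C :: "('c, 'o, 'm, 'y) v_monoidal_data_scheme" +
  assumes closed: "\<exists>R \<theta>. v_adjunction V C C (tensor_left V C a) R \<theta>"


section \<open>The completion\<close>

datatype ('c, 'o) formal = Formal 'c 'o (infix "\<triangleleft>" 65)

context
  fixes V :: "('o, 'm) rigid_data" (structure)
begin

fun completion_hom_obj ::
  "('c, 'o, 'm) v_monoidal_data \<Rightarrow> ('c, 'o) formal \<Rightarrow> ('c, 'o) formal \<Rightarrow> 'o" where
  "completion_hom_obj C (a \<triangleleft> u) (b \<triangleleft> v) = u\<^sup>\<star> \<odot> hom_obj C a b \<odot> v"

fun completion_ident :: "('c, 'o, 'm) v_monoidal_data \<Rightarrow> ('c, 'o) formal \<Rightarrow> 'm" where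
  "completion_ident C (a \<triangleleft> u) = coev V u \<Zsemi> (\<langle>u\<^sup>\<star>\<rangle> \<otimes> v_ident C a \<otimes> \<langle>u\<rangle>)"

fun completion_comp ::
  "('c, 'o, 'm) v_monoidal_data \<Rightarrow> ('c, 'o) formal \<Rightarrow> ('c, 'o) formal \<Rightarrow> ('c, 'o) formal \<Rightarrow> 'm"
  where
  "completion_comp C (a \<triangleleft> u) (b \<triangleleft> v) (c \<triangleleft> w) =
     (\<langle>u\<^sup>\<star> \<odot> hom_obj C a b\<rangle> \<otimes> ev V v \<otimes> \<langle>hom_obj C b c \<odot> w\<rangle>) \<Zsemi>
     (\<langle>u\<^sup>\<star>\<rangle> \<otimes> v_comp C a b c \<otimes> \<langle>w\<rangle>)"

fun completion_prod ::
  "('c, 'o, 'm) v_monoidal_data \<Rightarrow> ('c, 'o) formal \<Rightarrow> ('c, 'o) formal \<Rightarrow> ('c, 'o) formal" where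
  "completion_prod C (a \<triangleleft> u) (b \<triangleleft> v) = v_prod C a b \<triangleleft> (u \<odot> v)"

fun completion_tensor ::
  "('c, 'o, 'm) v_monoidal_data \<Rightarrow> ('c, 'o) formal \<Rightarrow> ('c, 'o) formal \<Rightarrow> ('c, 'o) formal
    \<Rightarrow> ('c, 'o) formal \<Rightarrow> 'm" where
  "completion_tensor C (a \<triangleleft> u) (c \<triangleleft> w) (b \<triangleleft> v) (d \<triangleleft> x) =
     (arr_inv V (\<beta> (v\<^sup>\<star>) (u\<^sup>\<star> \<odot> hom_obj C a c \<odot> w)) \<otimes> \<langle>hom_obj C b d \<odot> x\<rangle>) \<Zsemi>
     (\<langle>v\<^sup>\<star> \<odot> u\<^sup>\<star> \<odot> hom_obj C a c\<rangle> \<otimes> arr_inv V (\<beta> (hom_obj C b d) w) \<otimes> \<langle>x\<rangle>) \<Zsemi>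
     (\<langle>v\<^sup>\<star> \<odot> u\<^sup>\<star>\<rangle> \<otimes> v_tensor C a c b d \<otimes> \<langle>w \<odot> x\<rangle>)"

definition completion ::
  "('c, 'o, 'm) v_monoidal_data \<Rightarrow> (('c, 'o) formal, 'o, 'm) v_monoidal_data" where
  "completion C =
    \<lparr>hom_obj = completion_hom_obj C,
     v_ident = completion_ident C,
     v_comp = completion_comp C,
     v_unit = v_unit C \<triangleleft> \<I>,
     v_prod = completion_prod C,
     v_tensor = completion_tensor C\<rparr>"

text \<open>
  Below, \<open>H a\<close> is the right adjoint \<open>[a, -]\<close> of \<open>a \<otimes> -\<close>, and \<open>\<theta> a b c\<close> is the component
  \<open>C(ab \<rightarrow> c) \<rightarrow> C(b \<rightarrow> [a, c])\<close> of that adjunction.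
\<close>

fun internal_hom_obj ::
  "('c \<Rightarrow> ('c, 'c, 'm) v_functor_data) \<Rightarrow> ('c, 'o) formal \<Rightarrow> ('c, 'o) formal \<Rightarrow> ('c, 'o) formal"
  where
  "internal_hom_obj H (a \<triangleleft> u) (b \<triangleleft> v) = f_obj (H a) b \<triangleleft> (u\<^sup>\<star> \<odot> v)"

fun internal_hom_hom ::
  "('c, 'o, 'm) v_monoidal_data \<Rightarrow> ('c \<Rightarrow> ('c, 'c, 'm) v_functor_data)
    \<Rightarrow> ('c, 'o) formal \<Rightarrow> ('c, 'o) formal \<Rightarrow> ('c, 'o) formal \<Rightarrow> 'm" where
  "internal_hom_hom C H (a \<triangleleft> u) (b \<triangleleft> v) (c \<triangleleft> w) =
     (\<langle>v\<^sup>\<star>\<rangle> \<otimes> f_hom (H a) b c \<otimes> \<langle>w\<rangle>) \<Zsemi>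
     (\<langle>v\<^sup>\<star>\<rangle> \<otimes> coev V (u\<^sup>\<star>) \<otimes> \<langle>hom_obj C (f_obj (H a) b) (f_obj (H a) c) \<odot> w\<rangle>) \<Zsemi>
     (\<langle>v\<^sup>\<star> \<odot> (u\<^sup>\<star>)\<^sup>\<star>\<rangle> \<otimes>
        arr_inv V (\<beta> (hom_obj C (f_obj (H a) b) (f_obj (H a) c)) (u\<^sup>\<star>)) \<otimes> \<langle>w\<rangle>)"

definition completion_internal_hom ::
  "('c, 'o, 'm) v_monoidal_data \<Rightarrow> ('c \<Rightarrow> ('c, 'c, 'm) v_functor_data)
    \<Rightarrow> ('c, 'o) formal \<Rightarrow> (('c, 'o) formal, ('c, 'o) formal, 'm) v_functor_data" where
  "completion_internal_hom C H x =
     \<lparr>f_obj = internal_hom_obj H x, f_hom = internal_hom_hom C H x\<rparr>"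

fun completion_theta ::
  "('c, 'o, 'm) v_monoidal_data \<Rightarrow> ('c \<Rightarrow> 'c \<Rightarrow> 'c \<Rightarrow> 'm)
    \<Rightarrow> ('c, 'o) formal \<Rightarrow> ('c, 'o) formal \<Rightarrow> ('c, 'o) formal \<Rightarrow> 'm" where
  "completion_theta C \<theta> (a \<triangleleft> u) (b \<triangleleft> v) (c \<triangleleft> w) =
     \<langle>v\<^sup>\<star>\<rangle> \<otimes> (arr_inv V (\<beta> (hom_obj C (v_prod C a b) c) (u\<^sup>\<star>)) \<Zsemi> (\<theta> a b c \<otimes> \<langle>u\<^sup>\<star>\<rangle>)) \<otimes> \<langle>w\<rangle>"

end

end

theory Submission
  imports Defs
begin

text \<open>
  All identities involved are equalities of string diagrams. A diagram is written as a composite of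
  layers \<open>whisk L f R\<close>, each a single generator between identities; two diagrams agree up to planar
  isotopy when their layers can be permuted by \<open>exchange\<close>, and the remaining moves are naturality of
  the braiding, the hexagons and the zig-zag relations. Sliding a strand over \<open>ev V v\<close> turns its
  braiding with \<open>v\<close> into its inverse braiding with \<open>v\<^sup>\<star>\<close>, and vice versa. For the interchange law of
  the completion this cancels all crossings except that of the two inner hom objects, where the
  interchange law of \<open>C\<close> applies; for the left naturality of \<open>\<Theta>\<close> it turns the inverse braiding of the
  tensor product of the completion into the braiding in the inverse of \<open>\<Theta>\<close>.
\<close>

section \<open>Whiskering\<close>

context strict_monoidal_category
begin

text \<open>Source and target are total, so every arrow lies in its own hom set. This turns
  membership side conditions into equations of \<open>src\<close> and \<open>tgt\<close> that
  simplification decides.\<close>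

lemma hom_self: "f \<in> hom V (src V f) (tgt V f)"
  by (simp add: hom_def)

lemma src_hom: "f \<in> hom V u v \<Longrightarrow> src V f = u"
  and tgt_hom: "f \<in> hom V u v \<Longrightarrow> tgt V f = v"
  by (simp_all add: hom_def)

lemma src_ident [simp]: "src V \<langle>u\<rangle> = u"
  and tgt_ident [simp]: "tgt V \<langle>u\<rangle> = u"
  using ident_hom[of u] by (simp_all add: hom_def)

lemma src_comp [simp]: "tgt V f = src V g \<Longrightarrow> src V (f \<Zsemi> g) = src V f"
  and tgt_comp [simp]: "tgt V f = src V g \<Longrightarrow> tgt V (f \<Zsemi> g) = tgt V g"
  using comp_hom[OF hom_self[of f], of g "tgt V g"] hom_self[of g] by (simp_all add: hom_def)

lemma src_tensor [simp]: "src V (f \<otimes> g) = src V f \<odot> src V g"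
  and tgt_tensor [simp]: "tgt V (f \<otimes> g) = tgt V f \<odot> tgt V g"
  using tensor_hom[OF hom_self[of f] hom_self[of g]] by (simp_all add: hom_def)

lemma comp_assoc' [simp]:
  "\<lbrakk>tgt V f = src V g; tgt V g = src V h\<rbrakk> \<Longrightarrow> (f \<Zsemi> g) \<Zsemi> h = f \<Zsemi> (g \<Zsemi> h)"
  by (rule comp_assoc) (auto simp: hom_def)

lemma ident_comp [simp]: "u = src V f \<Longrightarrow> \<langle>u\<rangle> \<Zsemi> f = f"
  and comp_ident [simp]: "u = tgt V f \<Longrightarrow> f \<Zsemi> \<langle>u\<rangle> = f"
  using comp_ident_left[OF hom_self] comp_ident_right[OF hom_self] by simp_all

lemma tensor_comp':
  "\<lbrakk>tgt V f = src V g; tgt V h = src V k\<rbrakk> \<Longrightarrow> (f \<Zsemi> g) \<otimes> (h \<Zsemi> k) = (f \<otimes> h) \<Zsemi> (g \<otimes> k)"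
  by (rule tensor_comp) (auto simp: hom_def)

declare tensor_obj_assoc [simp] tensor_arr_assoc [simp] unit_obj_left [simp] unit_obj_right [simp]
  unit_arr_left [simp] unit_arr_right [simp]

text \<open>A layer has one generator between identity strands, with \<open>\<I>\<close> standing
  for no strands. With \<open>whisk_whisk\<close>, \<open>whisk_comp\<close> and
  \<open>comp_assoc'\<close> as rewrite rules, a diagram becomes a right-nested composite of
  layers.\<close>

definition whisk :: "'o \<Rightarrow> 'm \<Rightarrow> 'o \<Rightarrow> 'm" where
  "whisk L f R = \<langle>L\<rangle> \<otimes> f \<otimes> \<langle>R\<rangle>"

lemma src_whisk [simp]: "src V (whisk L f R) = L \<odot> src V f \<odot> R"
  and tgt_whisk [simp]: "tgt V (whisk L f R) = L \<odot> tgt V f \<odot> R"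
  by (simp_all add: whisk_def)

lemma whisk_unit [simp]: "whisk \<I> f \<I> = f"
  by (simp add: whisk_def)

lemma whisk_whisk [simp]: "whisk L (whisk M f N) R = whisk (L \<odot> M) f (N \<odot> R)"
proof -
  have "whisk L (whisk M f N) R = (\<langle>L\<rangle> \<otimes> \<langle>M\<rangle>) \<otimes> f \<otimes> (\<langle>N\<rangle> \<otimes> \<langle>R\<rangle>)"
    by (simp only: whisk_def tensor_arr_assoc)
  then show ?thesis
    by (simp only: whisk_def tensor_ident)
qed

lemma whisk_ident [simp]: "whisk L \<langle>u\<rangle> R = \<langle>L \<odot> u \<odot> R\<rangle>"
  by (simp add: whisk_def tensor_ident)

lemma whisk_comp [simp]:
  assumes "tgt V f = src V g"
  shows "whisk L (f \<Zsemi> g) R = whisk L f R \<Zsemi> whisk L g R"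
proof -
  have "(f \<Zsemi> g) \<otimes> \<langle>R\<rangle> = (f \<otimes> \<langle>R\<rangle>) \<Zsemi> (g \<otimes> \<langle>R\<rangle>)"
    using tensor_comp'[of f g "\<langle>R\<rangle>" "\<langle>R\<rangle>"] assms by simp
  then show ?thesis
    using tensor_comp'[of "\<langle>L\<rangle>" "\<langle>L\<rangle>" "f \<otimes> \<langle>R\<rangle>" "g \<otimes> \<langle>R\<rangle>"] assms by (simp add: whisk_def)
qed

lemma ident_tensor_whisk: "\<langle>L\<rangle> \<otimes> f = whisk L f \<I>"
  and tensor_ident_whisk: "f \<otimes> \<langle>R\<rangle> = whisk \<I> f R"
  and ident_tensor_ident_whisk: "\<langle>L\<rangle> \<otimes> f \<otimes> \<langle>R\<rangle> = whisk L f R"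
  by (simp_all add: whisk_def)

lemma tensor_whisk: "f \<otimes> g = whisk \<I> f (src V g) \<Zsemi> whisk (tgt V f) g \<I>"
  using tensor_comp'[of f "\<langle>tgt V f\<rangle>" "\<langle>src V g\<rangle>" g] by (simp add: whisk_def)

lemma tensor_whisk': "f \<otimes> g = whisk (src V f) g \<I> \<Zsemi> whisk \<I> f (tgt V g)"
  using tensor_comp'[of "\<langle>src V f\<rangle>" f g "\<langle>tgt V g\<rangle>"] by (simp add: whisk_def)

text \<open>The two ways of splitting \<open>f \<otimes> whisk M g \<I>\<close> into layers, with
  \<open>f\<close> first or with \<open>g\<close> first, agree. The middle object \<open>M\<close>
  lets the two generators be any distance apart.\<close>

lemma exchange:
  assumes "f \<in> hom V a b" "g \<in> hom V c d"
  shows "whisk L f (M \<odot> c \<odot> R) \<Zsemi> whisk (L \<odot> b \<odot> M) g R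
       = whisk (L \<odot> a \<odot> M) g R \<Zsemi> whisk L f (M \<odot> d \<odot> R)"
proof -
  note st = assms[THEN src_hom] assms[THEN tgt_hom]
  have "whisk \<I> f (M \<odot> c) \<Zsemi> whisk (b \<odot> M) g \<I> = whisk (a \<odot> M) g \<I> \<Zsemi> whisk \<I> f (M \<odot> d)"
    using tensor_whisk[of f "whisk M g \<I>"] tensor_whisk'[of f "whisk M g \<I>"] st by simp
  from arg_cong[OF this, of "\<lambda>h. whisk L h R"] show ?thesis
    by (simp add: st)
qed

lemma whisk_eq:
  assumes "f \<Zsemi> g = h" "tgt V f = src V g"
  shows "whisk L f R \<Zsemi> whisk L g R = whisk L h R"
  using assms by auto

text \<open>In right-nested composites a tail \<open>k\<close> hides the left side
  \<open>f \<Zsemi> g\<close> of an equation from rewriting; this form of the equation allows for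
  the tail.\<close>

lemma comp_eq_assoc:
  assumes "f \<Zsemi> g = h" "tgt V f = src V g" "tgt V g = src V k"
  shows "f \<Zsemi> (g \<Zsemi> k) = h \<Zsemi> k"
  using assms by auto

section \<open>Two-sided inverses of arrows\<close>

lemma inverse_arrows_sym: "inverse_arrows V f g \<Longrightarrow> inverse_arrows V g f"
  by (auto simp: inverse_arrows_def)

lemma arr_inv_eq:
  assumes "inverse_arrows V f g"
  shows "arr_inv V f = g"
  unfolding arr_inv_def
proof (rule the_equality)
  fix h assume h: "inverse_arrows V f h"
  have "h = h \<Zsemi> (f \<Zsemi> g)"
    using assms h by (simp add: inverse_arrows_def)
  also have "\<dots> = (h \<Zsemi> f) \<Zsemi> g"
    using assms h by (intro comp_assoc'[symmetric]) (auto simp: inverse_arrows_def)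
  also have "\<dots> = g"
    using assms h by (simp add: inverse_arrows_def del: comp_assoc')
  finally show "h = g" .
qed (fact assms)

lemma inverse_arrows_arr_inv: "is_iso V f \<Longrightarrow> inverse_arrows V f (arr_inv V f)"
  using arr_inv_eq by (auto simp: is_iso_def)

lemma inverse_arrows_comp:
  assumes "inverse_arrows V f f'" "inverse_arrows V g g'" "tgt V f = src V g"
  shows "inverse_arrows V (f \<Zsemi> g) (g' \<Zsemi> f')"
proof -
  have "f \<Zsemi> (g \<Zsemi> (g' \<Zsemi> f')) = f \<Zsemi> f'" "g' \<Zsemi> (f' \<Zsemi> (f \<Zsemi> g)) = g' \<Zsemi> g"
    using assms comp_eq_assoc[of g g' _ f'] comp_eq_assoc[of f' f _ g]
    by (simp_all add: inverse_arrows_def)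
  then show ?thesis
    using assms by (simp add: inverse_arrows_def)
qed

lemma inverse_arrows_whisk:
  assumes "inverse_arrows V f g"
  shows "inverse_arrows V (whisk L f R) (whisk L g R)"
proof -
  have "whisk L f R \<Zsemi> whisk L g R = whisk L (f \<Zsemi> g) R"
    "whisk L g R \<Zsemi> whisk L f R = whisk L (g \<Zsemi> f) R"
    using assms by (simp_all add: inverse_arrows_def del: whisk_comp add: whisk_comp[symmetric])
  then show ?thesis
    using assms by (simp add: inverse_arrows_def)
qed

lemma whisk_eq_assoc:
  assumes "f \<Zsemi> g = h" "tgt V f = src V g" "src V k = L \<odot> tgt V g \<odot> R"
  shows "whisk L f R \<Zsemi> (whisk L g R \<Zsemi> k) = whisk L h R \<Zsemi> k"
  using assms by auto

text \<open>The counterpart of \<open>comp_eq_assoc\<close> for left sides of three layers, which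
  arise when a morphism made of two layers slides through a crossing.\<close>

lemma comp_eq_assoc3:
  assumes "f \<Zsemi> (g \<Zsemi> h) = r" "tgt V f = src V g" "tgt V g = src V h" "tgt V h = src V k"
  shows "f \<Zsemi> (g \<Zsemi> (h \<Zsemi> k)) = r \<Zsemi> k"
  using assms by auto

end

section \<open>Inverse braidings\<close>

context braided_monoidal_category
begin

lemma src_braid [simp]: "src V (\<beta> u v) = u \<odot> v"
  and tgt_braid [simp]: "tgt V (\<beta> u v) = v \<odot> u"
  using braid_hom[of u v] by (simp_all add: hom_def)

text \<open>The indices name the strands in source order, so \<open>ibraid u v\<close> has the same
  type as \<open>\<beta> u v\<close> and is the reverse braiding; its naturality and hexagon rules
  then have the shape of those of \<open>\<beta>\<close>.\<close>

definition ibraid :: "'o \<Rightarrow> 'o \<Rightarrow> 'm" where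
  "ibraid u v = arr_inv V (\<beta> v u)"

lemma inverse_arrows_braid: "inverse_arrows V (\<beta> v u) (ibraid u v)"
  unfolding ibraid_def by (rule inverse_arrows_arr_inv[OF braid_iso])

lemma src_ibraid [simp]: "src V (ibraid u v) = u \<odot> v"
  and tgt_ibraid [simp]: "tgt V (ibraid u v) = v \<odot> u"
  and braid_ibraid [simp]: "\<beta> v u \<Zsemi> ibraid u v = \<langle>v \<odot> u\<rangle>"
  and ibraid_braid [simp]: "ibraid u v \<Zsemi> \<beta> v u = \<langle>u \<odot> v\<rangle>"
  using inverse_arrows_braid[of v u] by (simp_all add: inverse_arrows_def)

lemma ibraid_hom: "ibraid u v \<in> hom V (u \<odot> v) (v \<odot> u)"
  by (simp add: hom_def)

text \<open>Compose the naturality square of \<open>\<beta>\<close> at \<open>g \<otimes> f\<close>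
  with the inverse crossings on both sides.\<close>

lemma ibraid_natural:
  assumes "f \<in> hom V u u'" "g \<in> hom V v v'"
  shows "(f \<otimes> g) \<Zsemi> ibraid u' v' = ibraid u v \<Zsemi> (g \<otimes> f)"
proof -
  note st = assms[THEN src_hom] assms[THEN tgt_hom]
  have "ibraid u v \<Zsemi> ((g \<otimes> f) \<Zsemi> \<beta> v' u') \<Zsemi> ibraid u' v' = ibraid u v \<Zsemi> (g \<otimes> f)"
    by (simp add: st)
  moreover have "ibraid u v \<Zsemi> (\<beta> v u \<Zsemi> (f \<otimes> g)) = f \<otimes> g"
    by (subst comp_eq_assoc[OF ibraid_braid]) (simp_all add: st)
  ultimately show ?thesis
    by (simp only: braid_natural[OF assms(2,1)])
qed

lemma ibraid_natural_left:
  assumes "f \<in> hom V X X'"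
  shows "whisk L f (Y \<odot> R) \<Zsemi> whisk L (ibraid X' Y) R = whisk L (ibraid X Y) R \<Zsemi> whisk (L \<odot> Y) f R"
  using arg_cong[OF ibraid_natural[OF assms ident_hom[of Y]], of "\<lambda>h. whisk L h R"] assms
  by (simp add: ident_tensor_whisk tensor_ident_whisk src_hom tgt_hom)

lemma ibraid_natural_right:
  assumes "g \<in> hom V Y Y'"
  shows "whisk (L \<odot> X) g R \<Zsemi> whisk L (ibraid X Y') R = whisk L (ibraid X Y) R \<Zsemi> whisk L g (X \<odot> R)"
  using arg_cong[OF ibraid_natural[OF ident_hom[of X] assms], of "\<lambda>h. whisk L h R"] assms
  by (simp add: ident_tensor_whisk tensor_ident_whisk src_hom tgt_hom)

lemma braid_natural_left:
  assumes "f \<in> hom V X X'"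
  shows "whisk L f (Y \<odot> R) \<Zsemi> whisk L (\<beta> X' Y) R = whisk L (\<beta> X Y) R \<Zsemi> whisk (L \<odot> Y) f R"
  using arg_cong[OF braid_natural[OF assms ident_hom[of Y]], of "\<lambda>h. whisk L h R"] assms
  by (simp add: ident_tensor_whisk tensor_ident_whisk src_hom tgt_hom)

lemma braid_natural_right:
  assumes "g \<in> hom V Y Y'"
  shows "whisk (L \<odot> X) g R \<Zsemi> whisk L (\<beta> X Y') R = whisk L (\<beta> X Y) R \<Zsemi> whisk L g (X \<odot> R)"
  using arg_cong[OF braid_natural[OF ident_hom[of X] assms], of "\<lambda>h. whisk L h R"] assms
  by (simp add: ident_tensor_whisk tensor_ident_whisk src_hom tgt_hom)

section \<open>Hexagons for both braidings, and crossings with the unit\<close>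

lemma braid_tensor_left:
  "\<beta> (u \<odot> v) w = whisk u (\<beta> v w) \<I> \<Zsemi> whisk \<I> (\<beta> u w) v"
  and braid_tensor_right:
  "\<beta> u (v \<odot> w) = whisk \<I> (\<beta> u v) w \<Zsemi> whisk v (\<beta> u w) \<I>"
  using hexagon_left hexagon_right by (simp_all add: whisk_def)

text \<open>Inversion exchanges the two hexagons: \<open>ibraid (u \<odot> v) w\<close> inverts
  \<open>\<beta> w (u \<odot> v)\<close>, so the splitting in the right argument of
  \<open>\<beta>\<close> is inverted, in reverse order.\<close>

lemma ibraid_tensor_left:
  "ibraid (u \<odot> v) w = whisk u (ibraid v w) \<I> \<Zsemi> whisk \<I> (ibraid u w) v"
  unfolding ibraid_def[of "u \<odot> v"]
  by (rule arr_inv_eq)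
    (simp only: braid_tensor_right, intro inverse_arrows_comp inverse_arrows_whisk
        inverse_arrows_braid, simp)

lemma ibraid_tensor_right:
  "ibraid u (v \<odot> w) = whisk \<I> (ibraid u v) w \<Zsemi> whisk v (ibraid u w) \<I>"
  unfolding ibraid_def[of "u" "v \<odot> w"]
  by (rule arr_inv_eq)
    (simp only: braid_tensor_left, intro inverse_arrows_comp inverse_arrows_whisk
        inverse_arrows_braid, simp)

text \<open>The hexagon with both right factors equal to \<open>\<I>\<close> makes this crossing
  idempotent, and an invertible idempotent is an identity.\<close>

lemma braid_unit_right [simp]: "\<beta> u \<I> = \<langle>u\<rangle>"
proof -
  have "\<beta> u \<I> = \<beta> u \<I> \<Zsemi> \<beta> u \<I>"
    using braid_tensor_right[of u \<I> \<I>] by simp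
  then have "ibraid \<I> u \<Zsemi> \<beta> u \<I> = ibraid \<I> u \<Zsemi> (\<beta> u \<I> \<Zsemi> \<beta> u \<I>)"
    by (rule arg_cong)
  also have "\<dots> = \<beta> u \<I>"
    by (subst comp_eq_assoc[OF ibraid_braid]) simp_all
  finally show ?thesis by simp
qed

lemma braid_unit_left [simp]: "\<beta> \<I> u = \<langle>u\<rangle>"
proof -
  have "\<beta> \<I> u = \<beta> \<I> u \<Zsemi> \<beta> \<I> u"
    using braid_tensor_left[of \<I> \<I> u] by simp
  then have "ibraid u \<I> \<Zsemi> \<beta> \<I> u = ibraid u \<I> \<Zsemi> (\<beta> \<I> u \<Zsemi> \<beta> \<I> u)"
    by (rule arg_cong)
  also have "\<dots> = \<beta> \<I> u"
    by (subst comp_eq_assoc[OF ibraid_braid]) simp_all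
  finally show ?thesis by simp
qed

lemma ibraid_unit_left [simp]: "ibraid \<I> u = \<langle>u\<rangle>"
  and ibraid_unit_right [simp]: "ibraid u \<I> = \<langle>u\<rangle>"
  using ibraid_braid[of \<I> u] ibraid_braid[of u \<I>] by simp_all

lemma braid_ibraid_whisk_assoc [simp]:
    "src V k = L \<odot> v \<odot> u \<odot> R \<Longrightarrow> whisk L (\<beta> v u) R \<Zsemi> (whisk L (ibraid u v) R \<Zsemi> k) = k"
  and ibraid_braid_whisk_assoc [simp]:
    "src V k = L \<odot> u \<odot> v \<odot> R \<Longrightarrow> whisk L (ibraid u v) R \<Zsemi> (whisk L (\<beta> v u) R \<Zsemi> k) = k"
  using whisk_eq_assoc[OF braid_ibraid] whisk_eq_assoc[OF ibraid_braid] by simp_all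

text \<open>These are the crossings in the associativity law of the completion, with the tensor of
  \<open>C\<close> stripped off; \<open>P\<close>, \<open>v\<close>, \<open>s\<close> stand for
  duals and \<open>A\<close>, \<open>B\<close>, \<open>D\<close> for hom objects. The same pairs of
  strands cross on both sides, only in a different order.\<close>

lemma shuffle_assoc:
  "whisk \<I> (ibraid (P \<odot> A \<odot> w) v) (B \<odot> x \<odot> s \<odot> D \<odot> y) \<Zsemi>
   (whisk (v \<odot> P \<odot> A) (ibraid w B) (x \<odot> s \<odot> D \<odot> y) \<Zsemi>
   (whisk \<I> (ibraid (v \<odot> P \<odot> A \<odot> B \<odot> w \<odot> x) s) (D \<odot> y) \<Zsemi>
    whisk (s \<odot> v \<odot> P \<odot> A \<odot> B) (ibraid (w \<odot> x) D) y))
   = whisk (P \<odot> A \<odot> w) (ibraid (v \<odot> B \<odot> x) s) (D \<odot> y) \<Zsemi>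
   (whisk (P \<odot> A \<odot> w \<odot> s \<odot> v \<odot> B) (ibraid x D) y \<Zsemi>
   (whisk \<I> (ibraid (P \<odot> A \<odot> w) (s \<odot> v)) (B \<odot> D \<odot> x \<odot> y) \<Zsemi>
    whisk (s \<odot> v \<odot> P \<odot> A) (ibraid w (B \<odot> D)) (x \<odot> y)))" (is "?lhs = ?rhs")
proof -
  \<comment> \<open>Everything to the left of \<open>s\<close> counts as one morphism here, so
    naturality lets \<open>s\<close> cross before the first two factors are rearranged.\<close>
  have n1: "whisk (v \<odot> P \<odot> A) (ibraid w B) x
      \<in> hom V (v \<odot> P \<odot> A \<odot> w \<odot> B \<odot> x) (v \<odot> P \<odot> A \<odot> B \<odot> w \<odot> x)"
    and n2: "whisk \<I> (ibraid (P \<odot> A \<odot> w) v) (B \<odot> x)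
        \<in> hom V (P \<odot> A \<odot> w \<odot> v \<odot> B \<odot> x) (v \<odot> P \<odot> A \<odot> w \<odot> B \<odot> x)"
    by (simp_all add: hom_def)
  note m1 = ibraid_natural_left[OF n1, of \<I> s "D \<odot> y", simplified]
  note m2 = ibraid_natural_left[OF n2, of \<I> s "D \<odot> y", simplified]
  have "?lhs = whisk \<I> (ibraid (P \<odot> A \<odot> w \<odot> v \<odot> B \<odot> x) s) (D \<odot> y) \<Zsemi>
     (whisk s (ibraid (P \<odot> A \<odot> w) v) (B \<odot> x \<odot> D \<odot> y) \<Zsemi>
     (whisk (s \<odot> v \<odot> P \<odot> A) (ibraid w B) (x \<odot> D \<odot> y) \<Zsemi>
      whisk (s \<odot> v \<odot> P \<odot> A \<odot> B) (ibraid (w \<odot> x) D) y))"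
    by (simp add: m1 m2 comp_eq_assoc[OF m1] comp_eq_assoc[OF m2])
  \<comment> \<open>Hexagons split the crossing with \<open>s\<close> after the strand
    \<open>w\<close>, and the crossing with \<open>D\<close> between \<open>w\<close> and
    \<open>x\<close>.\<close>
  also have "\<dots> = whisk (P \<odot> A \<odot> w) (ibraid (v \<odot> B \<odot> x) s) (D \<odot> y) \<Zsemi>
     (whisk \<I> (ibraid (P \<odot> A \<odot> w) s) (v \<odot> B \<odot> x \<odot> D \<odot> y) \<Zsemi>
     (whisk s (ibraid (P \<odot> A \<odot> w) v) (B \<odot> x \<odot> D \<odot> y) \<Zsemi>
     (whisk (s \<odot> v \<odot> P \<odot> A) (ibraid w B) (x \<odot> D \<odot> y) \<Zsemi>
     (whisk (s \<odot> v \<odot> P \<odot> A \<odot> B \<odot> w) (ibraid x D) y \<Zsemi>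
      whisk (s \<odot> v \<odot> P \<odot> A \<odot> B) (ibraid w D) (x \<odot> y)))))"
    using ibraid_tensor_left[of "P \<odot> A \<odot> w" "v \<odot> B \<odot> x" s] ibraid_tensor_left[of w x D] by simp
  also have "\<dots> = ?rhs"
  proof -
    \<comment> \<open>It remains to move the crossing of \<open>x\<close> and \<open>D\<close> ahead
      of crossings on disjoint strands; the hexagon in the right argument regroups the rest.\<close>
    note e1 = exchange[OF ibraid_hom[of "P \<odot> A \<odot> w" s] ibraid_hom[of x D], of \<I> "v \<odot> B" y,
        simplified, symmetric]
    note e2 = exchange[OF ibraid_hom[of "P \<odot> A \<odot> w" v] ibraid_hom[of x D], of s B y,
        simplified, symmetric]
    note e3 = exchange[OF ibraid_hom[of w B] ibraid_hom[of x D], of "s \<odot> v \<odot> P \<odot> A" \<I> y,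
        simplified, symmetric]
    show ?thesis
      by (simp add: ibraid_tensor_right e1 e2 e3 comp_eq_assoc[OF e1] comp_eq_assoc[OF e2]
          comp_eq_assoc[OF e3])
  qed
  finally show ?thesis .
qed

end

section \<open>Duals\<close>

context braided_rigid_category
begin

lemma ev_hom: "ev V v \<in> hom V (v \<odot> v\<^sup>\<star>) \<I>"
  and coev_hom: "coev V v \<in> hom V \<I> (v\<^sup>\<star> \<odot> v)"
  using dual_is_dual[of v] by (simp_all add: is_dual_def)

lemma src_ev [simp]: "src V (ev V v) = v \<odot> v\<^sup>\<star>"
  and tgt_ev [simp]: "tgt V (ev V v) = \<I>"
  and src_coev [simp]: "src V (coev V v) = \<I>"
  and tgt_coev [simp]: "tgt V (coev V v) = v\<^sup>\<star> \<odot> v"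
  using ev_hom[of v] coev_hom[of v] by (simp_all add: hom_def)

lemma zigzag: "whisk (L \<odot> v) (coev V v) R \<Zsemi> whisk L (ev V v) (v \<odot> R) = \<langle>L \<odot> v \<odot> R\<rangle>"
proof -
  have "whisk v (coev V v) \<I> \<Zsemi> whisk \<I> (ev V v) v = \<langle>v\<rangle>"
    using dual_is_dual[of v] by (simp add: is_dual_def whisk_def)
  from whisk_eq[OF this, of L R] show ?thesis by simp
qed

lemma zigzag_dual:
  "whisk L (coev V v) (v\<^sup>\<star> \<odot> R) \<Zsemi> whisk (L \<odot> v\<^sup>\<star>) (ev V v) R = \<langle>L \<odot> v\<^sup>\<star> \<odot> R\<rangle>"
proof -
  have "whisk \<I> (coev V v) (v\<^sup>\<star>) \<Zsemi> whisk (v\<^sup>\<star>) (ev V v) \<I> = \<langle>v\<^sup>\<star>\<rangle>"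
    using dual_is_dual[of v] by (simp add: is_dual_def whisk_def)
  from whisk_eq[OF this, of L R] show ?thesis by simp
qed

section \<open>Sliding strands over evaluations\<close>

text \<open>Naturality of \<open>ibraid Q _\<close> at \<open>ev V x\<close>: the crossing with
  \<open>\<I>\<close> vanishes, and the crossing with \<open>x \<odot> x\<^sup>\<star>\<close>
  splits in two, the first of which cancels \<open>\<beta> x Q\<close>.\<close>

lemma braid_ev:
  "whisk L (\<beta> x Q) (x\<^sup>\<star> \<odot> R) \<Zsemi> whisk (L \<odot> Q) (ev V x) R
   = whisk (L \<odot> x) (ibraid Q (x\<^sup>\<star>)) R \<Zsemi> whisk L (ev V x) (Q \<odot> R)"
proof -
  have "whisk (L \<odot> Q) (ev V x) R = whisk L (ibraid Q x) (x\<^sup>\<star> \<odot> R) \<Zsemi>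
      (whisk (L \<odot> x) (ibraid Q (x\<^sup>\<star>)) R \<Zsemi> whisk L (ev V x) (Q \<odot> R))"
    using ibraid_natural_right[OF ev_hom[of x], of L Q R] by (simp add: ibraid_tensor_right)
  then show ?thesis by simp
qed

lemma ibraid_ev:
  "whisk L (ibraid w B) (w\<^sup>\<star> \<odot> R) \<Zsemi> whisk (L \<odot> B) (ev V w) R
   = whisk (L \<odot> w) (\<beta> B (w\<^sup>\<star>)) R \<Zsemi> whisk L (ev V w) (B \<odot> R)"
proof -
  have "whisk (L \<odot> B) (ev V w) R = whisk L (\<beta> B w) (w\<^sup>\<star> \<odot> R) \<Zsemi>
      (whisk (L \<odot> w) (\<beta> B (w\<^sup>\<star>)) R \<Zsemi> whisk L (ev V w) (B \<odot> R))"
    using braid_natural_right[OF ev_hom[of w], of L B R] by (simp add: braid_tensor_right)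
  then show ?thesis by simp
qed

text \<open>By \<open>coev_tensor\<close> at \<open>\<I> \<odot> u\<close>, the arrow
  \<open>coev V u\<close> absorbs \<open>coev V \<I>\<close>; the zig-zag relation carries this over
  to the strand \<open>u\<^sup>\<star>\<close>.\<close>

lemma ident_dual_tensor_coev_unit: "whisk (u\<^sup>\<star>) (coev V \<I>) \<I> = \<langle>u\<^sup>\<star>\<rangle>"
proof -
  have du: "u\<^sup>\<star> \<odot> \<I>\<^sup>\<star> = u\<^sup>\<star>" using dual_tensor[of \<I> u] by simp
  have c: "coev V u = coev V u \<Zsemi> whisk (u\<^sup>\<star>) (coev V \<I>) u"
    using coev_tensor[of \<I> u] by (simp add: whisk_def)
  have "\<langle>u\<^sup>\<star>\<rangle> = whisk \<I> (coev V u) (u\<^sup>\<star>) \<Zsemi> whisk (u\<^sup>\<star>) (ev V u) \<I>"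
    using zigzag_dual[of \<I> u \<I>] by simp
  also have "\<dots> = whisk \<I> (coev V u) (u\<^sup>\<star>) \<Zsemi>
      (whisk (u\<^sup>\<star>) (coev V \<I>) (u \<odot> u\<^sup>\<star>) \<Zsemi> whisk (u\<^sup>\<star>) (ev V u) \<I>)"
    \<comment> \<open>\<open>du\<close> identifies
      \<open>u\<^sup>\<star> \<odot> \<I>\<^sup>\<star>\<close> with \<open>u\<^sup>\<star>\<close>;
      bracketing to the left exposes this product inside longer ones.\<close>
    by (subst c, insert du) (simp add: tensor_obj_assoc[symmetric] del: tensor_obj_assoc)
  also have "\<dots> = (whisk \<I> (coev V u) (u\<^sup>\<star>) \<Zsemi> whisk (u\<^sup>\<star>) (ev V u) \<I>) \<Zsemi> whisk (u\<^sup>\<star>) (coev V \<I>) \<I>"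
    using exchange[OF coev_hom[of \<I>] ev_hom[of u], of "u\<^sup>\<star>" \<I> \<I>] du
    by simp
  also have "\<dots> = whisk (u\<^sup>\<star>) (coev V \<I>) \<I>"
    using zigzag_dual[of \<I> u \<I>] by simp
  finally show ?thesis ..
qed

lemma coev_unit_tensor_ident_dual: "whisk \<I> (coev V \<I>) (u\<^sup>\<star>) = \<langle>u\<^sup>\<star>\<rangle>"
proof -
  have du: "\<I>\<^sup>\<star> \<odot> u\<^sup>\<star> = u\<^sup>\<star>" using dual_tensor[of u \<I>] by simp
  have c: "coev V u = coev V \<I> \<Zsemi> whisk (\<I>\<^sup>\<star>) (coev V u) \<I>"
    using coev_tensor[of u \<I>] by (simp add: whisk_def)
  \<comment> \<open>Here \<open>coev_tensor\<close> creates \<open>coev V \<I>\<close> first;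
    exchanging it with \<open>coev V u\<close> gives the absorbing form.\<close>
  also have "\<dots> = coev V u \<Zsemi> whisk \<I> (coev V \<I>) (u\<^sup>\<star> \<odot> u)"
    using exchange[OF coev_hom[of \<I>] coev_hom[of u], of \<I> \<I> \<I>] by simp
  finally have c: "coev V u = coev V u \<Zsemi> whisk \<I> (coev V \<I>) (u\<^sup>\<star> \<odot> u)" .
  have "\<langle>u\<^sup>\<star>\<rangle> = whisk \<I> (coev V u) (u\<^sup>\<star>) \<Zsemi> whisk (u\<^sup>\<star>) (ev V u) \<I>"
    using zigzag_dual[of \<I> u \<I>] by simp
  also have "\<dots> = whisk \<I> (coev V u) (u\<^sup>\<star>) \<Zsemi>
      (whisk \<I> (coev V \<I>) (u\<^sup>\<star> \<odot> u \<odot> u\<^sup>\<star>) \<Zsemi> whisk (u\<^sup>\<star>) (ev V u) \<I>)"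
    by (subst c, insert du) (simp add: tensor_obj_assoc[symmetric] del: tensor_obj_assoc)
  also have "\<dots> = (whisk \<I> (coev V u) (u\<^sup>\<star>) \<Zsemi> whisk (u\<^sup>\<star>) (ev V u) \<I>) \<Zsemi> whisk \<I> (coev V \<I>) (u\<^sup>\<star>)"
    using exchange[OF coev_hom[of \<I>] ev_hom[of u], of \<I> "u\<^sup>\<star>" \<I>] du
      du[THEN arg_cong, of "\<lambda>x. x \<odot> u \<odot> u\<^sup>\<star>"]
    by simp
  also have "\<dots> = whisk \<I> (coev V \<I>) (u\<^sup>\<star>)"
    using zigzag_dual[of \<I> u \<I>] by simp
  finally show ?thesis ..
qed

text \<open>These are the crossings and evaluations in the interchange law of the completion, with
  the tensor and composition of \<open>C\<close> stripped off; \<open>P\<close> and \<open>v\<close>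
  stand for duals. The right side is simplified until it becomes the left one.\<close>

lemma shuffle_interchange:
  "whisk \<I> (ibraid (P \<odot> A \<odot> w) v) (B \<odot> x \<odot> w\<^sup>\<star> \<odot> A' \<odot> y \<odot> x\<^sup>\<star> \<odot> B' \<odot> z) \<Zsemi>
   (whisk (v \<odot> P \<odot> A) (ibraid w B) (x \<odot> w\<^sup>\<star> \<odot> A' \<odot> y \<odot> x\<^sup>\<star> \<odot> B' \<odot> z) \<Zsemi>
   (whisk (v \<odot> P \<odot> A \<odot> B \<odot> w \<odot> x) (ibraid (w\<^sup>\<star> \<odot> A' \<odot> y) (x\<^sup>\<star>)) (B' \<odot> z) \<Zsemi>
   (whisk (v \<odot> P \<odot> A \<odot> B \<odot> w \<odot> x \<odot> x\<^sup>\<star> \<odot> w\<^sup>\<star> \<odot> A') (ibraid y B') z \<Zsemi>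
   (whisk (v \<odot> P \<odot> A \<odot> B \<odot> w) (ev V x) (w\<^sup>\<star> \<odot> A' \<odot> B' \<odot> y \<odot> z) \<Zsemi>
   (whisk (v \<odot> P \<odot> A \<odot> B) (ev V w) (A' \<odot> B' \<odot> y \<odot> z) \<Zsemi>
    whisk (v \<odot> P \<odot> A) (\<beta> B A') (B' \<odot> y \<odot> z))))))
   = whisk (P \<odot> A \<odot> w) (\<beta> (v \<odot> B \<odot> x) (w\<^sup>\<star> \<odot> A' \<odot> y)) (x\<^sup>\<star> \<odot> B' \<odot> z) \<Zsemi>
   (whisk (P \<odot> A) (ev V w) (A' \<odot> y \<odot> v \<odot> B \<odot> x \<odot> x\<^sup>\<star> \<odot> B' \<odot> z) \<Zsemi>
   (whisk (P \<odot> A \<odot> A' \<odot> y \<odot> v \<odot> B) (ev V x) (B' \<odot> z) \<Zsemi>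
   (whisk \<I> (ibraid (P \<odot> A \<odot> A' \<odot> y) v) (B \<odot> B' \<odot> z) \<Zsemi>
    whisk (v \<odot> P \<odot> A \<odot> A') (ibraid y (B \<odot> B')) z)))" (is "?lhs = ?rhs")
proof -
  let ?Q = "w\<^sup>\<star> \<odot> A' \<odot> y"
  note e1 = exchange[OF ev_hom[of w] ev_hom[of x], of "P \<odot> A" "A' \<odot> y \<odot> v \<odot> B" "B' \<odot> z",
      simplified]
  note e2 = exchange[OF braid_hom[of v ?Q] ev_hom[of x], of "P \<odot> A \<odot> w" B "B' \<odot> z", simplified]
  note e3 = exchange[OF braid_hom[of B ?Q] ev_hom[of x], of "P \<odot> A \<odot> w \<odot> v" \<I> "B' \<odot> z",
      simplified]
  note e4 = braid_ev[of "P \<odot> A \<odot> w \<odot> v \<odot> B" x ?Q "B' \<odot> z", simplified]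
  \<comment> \<open>\<open>ev V x\<close> moves forward until it meets the crossing of
    \<open>x\<close> with \<open>?Q\<close>, which \<open>braid_ev\<close> turns into the inverse
    crossing with \<open>x\<^sup>\<star>\<close>.\<close>
  have "?rhs = whisk (P \<odot> A \<odot> w \<odot> v \<odot> B \<odot> x) (ibraid ?Q (x\<^sup>\<star>)) (B' \<odot> z) \<Zsemi>
    (whisk (P \<odot> A \<odot> w \<odot> v \<odot> B) (ev V x) (?Q \<odot> B' \<odot> z) \<Zsemi>
    (whisk (P \<odot> A \<odot> w \<odot> v) (\<beta> B ?Q) (B' \<odot> z) \<Zsemi>
    (whisk (P \<odot> A \<odot> w) (\<beta> v ?Q) (B \<odot> B' \<odot> z) \<Zsemi>
    (whisk (P \<odot> A) (ev V w) (A' \<odot> y \<odot> v \<odot> B \<odot> B' \<odot> z) \<Zsemi>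
    (whisk \<I> (ibraid (P \<odot> A \<odot> A' \<odot> y) v) (B \<odot> B' \<odot> z) \<Zsemi>
     whisk (v \<odot> P \<odot> A \<odot> A') (ibraid y (B \<odot> B')) z)))))"
    by (simp add: braid_tensor_left comp_eq_assoc[OF e1] comp_eq_assoc[OF e2] comp_eq_assoc[OF e3]
        comp_eq_assoc[OF e4])
  \<comment> \<open>Naturality moves \<open>ev V w\<close> behind the crossing with
    \<open>v\<close>; the enlarged crossing splits, and its part \<open>ibraid ?Q v\<close> cancels
    \<open>\<beta> v ?Q\<close>.\<close>
  also have "\<dots> = whisk (P \<odot> A \<odot> w \<odot> v \<odot> B \<odot> x) (ibraid ?Q (x\<^sup>\<star>)) (B' \<odot> z) \<Zsemi>
    (whisk (P \<odot> A \<odot> w \<odot> v \<odot> B) (ev V x) (?Q \<odot> B' \<odot> z) \<Zsemi>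
    (whisk (P \<odot> A \<odot> w \<odot> v) (\<beta> B ?Q) (B' \<odot> z) \<Zsemi>
    (whisk \<I> (ibraid (P \<odot> A \<odot> w) v) (?Q \<odot> B \<odot> B' \<odot> z) \<Zsemi>
    (whisk (v \<odot> P \<odot> A) (ev V w) (A' \<odot> y \<odot> B \<odot> B' \<odot> z) \<Zsemi>
     whisk (v \<odot> P \<odot> A \<odot> A') (ibraid y (B \<odot> B')) z))))"
  proof -
    have h: "whisk (P \<odot> A) (ev V w) (A' \<odot> y) \<in> hom V (P \<odot> A \<odot> w \<odot> ?Q) (P \<odot> A \<odot> A' \<odot> y)"
      by (simp add: hom_def)
    note n = ibraid_natural_left[OF h, of \<I> v "B \<odot> B' \<odot> z", simplified]
    show ?thesis
      using ibraid_tensor_left[of "P \<odot> A \<odot> w" ?Q v]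
      by (simp add: comp_eq_assoc[OF n])
  qed
  \<comment> \<open>Once \<open>\<beta> B ?Q\<close> is split over its three strands, the part with
    \<open>y\<close> cancels the crossing \<open>ibraid y B\<close> contained in
    \<open>ibraid y (B \<odot> B')\<close>.\<close>
  also have "\<dots> = whisk (P \<odot> A \<odot> w \<odot> v \<odot> B \<odot> x) (ibraid ?Q (x\<^sup>\<star>)) (B' \<odot> z) \<Zsemi>
    (whisk (P \<odot> A \<odot> w \<odot> v \<odot> B) (ev V x) (?Q \<odot> B' \<odot> z) \<Zsemi>
    (whisk \<I> (ibraid (P \<odot> A \<odot> w) v) (B \<odot> ?Q \<odot> B' \<odot> z) \<Zsemi>
    (whisk (v \<odot> P \<odot> A \<odot> w) (\<beta> B (w\<^sup>\<star>)) (A' \<odot> y \<odot> B' \<odot> z) \<Zsemi>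
    (whisk (v \<odot> P \<odot> A) (ev V w) (B \<odot> A' \<odot> y \<odot> B' \<odot> z) \<Zsemi>
    (whisk (v \<odot> P \<odot> A) (\<beta> B A') (y \<odot> B' \<odot> z) \<Zsemi>
     whisk (v \<odot> P \<odot> A \<odot> A' \<odot> B) (ibraid y B') z)))))"
  proof -
    note e5 = exchange[OF ibraid_hom[of "P \<odot> A \<odot> w" v] braid_hom[of B ?Q], of \<I> \<I> "B' \<odot> z",
        simplified, symmetric]
    note e6 = exchange[OF ev_hom[of w] braid_hom[of B y], of "v \<odot> P \<odot> A" "A'" "B' \<odot> z",
        simplified, symmetric]
    note e7 = exchange[OF ev_hom[of w] braid_hom[of B A'], of "v \<odot> P \<odot> A" \<I> "y \<odot> B' \<odot> z",
        simplified, symmetric]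
    show ?thesis
      by (simp add: comp_eq_assoc[OF e5]) (simp add: braid_tensor_right ibraid_tensor_right
          comp_eq_assoc[OF e6] comp_eq_assoc[OF e7])
  qed
  \<comment> \<open>The mirror slide \<open>ibraid_ev\<close> turns the crossing of \<open>B\<close>
    with \<open>w\<^sup>\<star>\<close> into one with \<open>w\<close>.\<close>
  also have "\<dots> = whisk (P \<odot> A \<odot> w \<odot> v \<odot> B \<odot> x) (ibraid ?Q (x\<^sup>\<star>)) (B' \<odot> z) \<Zsemi>
    (whisk (P \<odot> A \<odot> w \<odot> v \<odot> B) (ev V x) (?Q \<odot> B' \<odot> z) \<Zsemi>
    (whisk \<I> (ibraid (P \<odot> A \<odot> w) v) (B \<odot> ?Q \<odot> B' \<odot> z) \<Zsemi>
    (whisk (v \<odot> P \<odot> A) (ibraid w B) (w\<^sup>\<star> \<odot> A' \<odot> y \<odot> B' \<odot> z) \<Zsemi>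
    (whisk (v \<odot> P \<odot> A \<odot> B) (ev V w) (A' \<odot> y \<odot> B' \<odot> z) \<Zsemi>
    (whisk (v \<odot> P \<odot> A) (\<beta> B A') (y \<odot> B' \<odot> z) \<Zsemi>
     whisk (v \<odot> P \<odot> A \<odot> A' \<odot> B) (ibraid y B') z)))))"
    using comp_eq_assoc[OF ibraid_ev[of "v \<odot> P \<odot> A" w B "A' \<odot> y \<odot> B' \<odot> z"]] by simp
  also have "\<dots> = ?lhs"
  proof -
    note f1 = exchange[OF ev_hom[of x] ibraid_hom[of y B'], of "v \<odot> P \<odot> A \<odot> B \<odot> w" "w\<^sup>\<star> \<odot> A'" z,
        simplified, symmetric]
    note f2 = exchange[OF ev_hom[of w] ibraid_hom[of y B'], of "v \<odot> P \<odot> A \<odot> B" "A'" z,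
        simplified, symmetric]
    note f3 = exchange[OF braid_hom[of B A'] ibraid_hom[of y B'], of "v \<odot> P \<odot> A" \<I> z,
        simplified, symmetric]
    note f4 = exchange[OF ibraid_hom[of w B] ibraid_hom[of ?Q "x\<^sup>\<star>"], of "v \<odot> P \<odot> A" x "B' \<odot> z",
        simplified]
    note f5 = exchange[OF ibraid_hom[of "P \<odot> A \<odot> w" v] ibraid_hom[of ?Q "x\<^sup>\<star>"],
        of \<I> "B \<odot> x" "B' \<odot> z", simplified]
    note f6 = exchange[OF ibraid_hom[of w B] ev_hom[of x], of "v \<odot> P \<odot> A" \<I> "?Q \<odot> B' \<odot> z",
        simplified]
    note f7 = exchange[OF ibraid_hom[of "P \<odot> A \<odot> w" v] ev_hom[of x], of \<I> B "?Q \<odot> B' \<odot> z",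
        simplified]
    show ?thesis
      by (simp add: f3 comp_eq_assoc[OF f1] comp_eq_assoc[OF f2] comp_eq_assoc[OF f3]
          comp_eq_assoc[OF f4]
          comp_eq_assoc[OF f5] comp_eq_assoc[OF f6] comp_eq_assoc[OF f7])
  qed
  finally show ?thesis ..
qed

text \<open>The dual of \<open>\<I>\<close> need not be \<open>\<I>\<close> itself, but \<open>dual_tensor\<close> makes it a strict unit for duals.\<close>

lemma dual_unit_right: "u\<^sup>\<star> \<odot> \<I>\<^sup>\<star> = u\<^sup>\<star>"
  and dual_unit_left: "\<I>\<^sup>\<star> \<odot> u\<^sup>\<star> = u\<^sup>\<star>"
  using dual_tensor[of \<I> u] dual_tensor[of u \<I>] by simp_all

lemma dual_unit_right_assoc: "u\<^sup>\<star> \<odot> (\<I>\<^sup>\<star> \<odot> X) = u\<^sup>\<star> \<odot> X"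
  and dual_unit_left_assoc: "\<I>\<^sup>\<star> \<odot> (u\<^sup>\<star> \<odot> X) = u\<^sup>\<star> \<odot> X"
  using arg_cong[OF dual_unit_right, of "\<lambda>x. x \<odot> X"] arg_cong[OF dual_unit_left, of "\<lambda>x. x \<odot> X"]
  by simp_all

lemmas dual_unit = dual_unit_right dual_unit_left dual_unit_right_assoc dual_unit_left_assoc

lemma coev_unit_whisk_right: "whisk (u\<^sup>\<star>) (coev V \<I>) R = \<langle>u\<^sup>\<star> \<odot> R\<rangle>"
  and coev_unit_whisk_left: "whisk L (coev V \<I>) (u\<^sup>\<star> \<odot> R) = \<langle>L \<odot> u\<^sup>\<star> \<odot> R\<rangle>"
  using arg_cong[OF ident_dual_tensor_coev_unit[of u], of "\<lambda>h. whisk \<I> h R"]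
    arg_cong[OF coev_unit_tensor_ident_dual[of u], of "\<lambda>h. whisk L h R"] by simp_all

end

section \<open>Enriched categories\<close>

context v_category
begin

lemma src_v_ident [simp]: "src V (v_ident C a) = \<I>"
  and tgt_v_ident [simp]: "tgt V (v_ident C a) = hom_obj C a a"
  and src_v_comp [simp]: "src V (v_comp C a b c) = hom_obj C a b \<odot> hom_obj C b c"
  and tgt_v_comp [simp]: "tgt V (v_comp C a b c) = hom_obj C a c"
  using v_ident_hom[of a] v_comp_hom[of a b c] by (simp_all add: hom_def)

lemma v_comp_assoc_whisk:
  "whisk L (v_comp C a b c) (hom_obj C c d \<odot> R) \<Zsemi> whisk L (v_comp C a c d) R
   = whisk (L \<odot> hom_obj C a b) (v_comp C b c d) R \<Zsemi> whisk L (v_comp C a b d) R"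
  using arg_cong[OF v_comp_assoc, of "\<lambda>h. whisk L h R"]
  by (simp add: ident_tensor_whisk tensor_ident_whisk)

lemma v_ident_left_whisk:
  "whisk L (v_ident C a) (hom_obj C a b \<odot> R) \<Zsemi> whisk L (v_comp C a a b) R
   = \<langle>L \<odot> hom_obj C a b \<odot> R\<rangle>"
  and v_ident_right_whisk:
  "whisk (L \<odot> hom_obj C a b) (v_ident C b) R \<Zsemi> whisk L (v_comp C a b b) R
   = \<langle>L \<odot> hom_obj C a b \<odot> R\<rangle>"
  using arg_cong[OF v_ident_left, of "\<lambda>h. whisk L h R"]
    arg_cong[OF v_ident_right, of "\<lambda>h. whisk L h R"]
  by (simp_all add: ident_tensor_whisk tensor_ident_whisk)

end

context v_monoidal_category
begin

lemma src_v_tensor [simp]: "src V (v_tensor C a b c d) = hom_obj C a b \<odot> hom_obj C c d"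
  and tgt_v_tensor [simp]: "tgt V (v_tensor C a b c d) = hom_obj C (v_prod C a c) (v_prod C b d)"
  using v_tensor_hom[of a b c d] by (simp_all add: hom_def)

lemma v_tensor_assoc_whisk:
  "whisk L (v_tensor C a b c d) (hom_obj C e f \<odot> R) \<Zsemi>
     whisk L (v_tensor C (v_prod C a c) (v_prod C b d) e f) R
   = whisk (L \<odot> hom_obj C a b) (v_tensor C c d e f) R \<Zsemi>
     whisk L (v_tensor C a b (v_prod C c e) (v_prod C d f)) R"
  using arg_cong[OF v_tensor_assoc, of "\<lambda>h. whisk L h R"]
  by (simp add: ident_tensor_whisk tensor_ident_whisk v_prod_assoc)

lemma v_tensor_unit_left_whisk:
  "whisk L (v_ident C (v_unit C)) (hom_obj C a b \<odot> R) \<Zsemi>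
     whisk L (v_tensor C (v_unit C) (v_unit C) a b) R
   = \<langle>L \<odot> hom_obj C a b \<odot> R\<rangle>"
  and v_tensor_unit_right_whisk:
  "whisk (L \<odot> hom_obj C a b) (v_ident C (v_unit C)) R \<Zsemi>
     whisk L (v_tensor C a b (v_unit C) (v_unit C)) R
   = \<langle>L \<odot> hom_obj C a b \<odot> R\<rangle>"
  using arg_cong[OF v_tensor_unit_left, of "\<lambda>h. whisk L h R"]
    arg_cong[OF v_tensor_unit_right, of "\<lambda>h. whisk L h R"]
  by (simp_all add: ident_tensor_whisk tensor_ident_whisk v_unit_left v_unit_right)

lemma v_tensor_ident_whisk:
  "whisk L (v_ident C a) R \<Zsemi> (whisk (L \<odot> hom_obj C a a) (v_ident C b) R \<Zsemi>
     whisk L (v_tensor C a a b b) R)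
   = whisk L (v_ident C (v_prod C a b)) R"
  using arg_cong[OF v_tensor_ident, of "\<lambda>h. whisk L h R"]
  by (simp add: tensor_whisk)

lemma braided_interchange_whisk:
  "whisk L (v_tensor C a b d e) (hom_obj C b c \<odot> hom_obj C e f \<odot> R) \<Zsemi>
     (whisk (L \<odot> hom_obj C (v_prod C a d) (v_prod C b e)) (v_tensor C b c e f) R \<Zsemi>
      whisk L (v_comp C (v_prod C a d) (v_prod C b e) (v_prod C c f)) R)
   = whisk (L \<odot> hom_obj C a b) (\<beta> (hom_obj C d e) (hom_obj C b c)) (hom_obj C e f \<odot> R) \<Zsemi>
     (whisk L (v_comp C a b c) (hom_obj C d e \<odot> hom_obj C e f \<odot> R) \<Zsemi>
      (whisk (L \<odot> hom_obj C a c) (v_comp C d e f) R \<Zsemi> whisk L (v_tensor C a c d f) R))"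
  using arg_cong[OF braided_interchange[of a b d e c f], of "\<lambda>h. whisk L h R"]
  by (simp add: tensor_whisk[of "v_tensor C a b d e"] tensor_whisk[of "v_comp C a b c"]
      ident_tensor_ident_whisk)

text \<open>\<open>tensor_left\<close> is functorial because \<open>\<beta>\<close> is trivial against the identity element
  \<open>v_ident C a\<close>, whose source is the unit.\<close>

lemma tensor_left_v_functor: "v_functor V C C (tensor_left V C a)"
proof unfold_locales
  let ?F = "tensor_left V C a" and ?j = "v_ident C a"
  have F: "f_obj ?F b = v_prod C a b"
    "f_hom ?F b c = whisk \<I> ?j (hom_obj C b c) \<Zsemi> v_tensor C a a b c" for b c
    by (simp_all add: tensor_left_def tensor_ident_whisk)
  show "f_hom ?F b c \<in> hom V (hom_obj C b c) (hom_obj C (f_obj ?F b) (f_obj ?F c))" for b c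
    by (simp add: F hom_def)
  show "v_ident C b \<Zsemi> f_hom ?F b b = v_ident C (f_obj ?F b)" for b
  proof -
    note e = exchange[OF v_ident_hom[of a] v_ident_hom[of b], of \<I> \<I> \<I>, simplified, symmetric]
    show ?thesis
      using v_tensor_ident_whisk[of \<I> a \<I> b] by (simp add: F comp_eq_assoc[OF e])
  qed
  show "v_comp C b c d \<Zsemi> f_hom ?F b d =
      (f_hom ?F b c \<otimes> f_hom ?F c d) \<Zsemi> v_comp C (f_obj ?F b) (f_obj ?F c) (f_obj ?F d)" for b c d
  proof -
    let ?B = "hom_obj C b c" and ?D = "hom_obj C c d" and ?A = "hom_obj C a a"
    have "(f_hom ?F b c \<otimes> f_hom ?F c d) \<Zsemi> v_comp C (f_obj ?F b) (f_obj ?F c) (f_obj ?F d)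
       = whisk \<I> ?j (?B \<odot> ?D) \<Zsemi> (whisk (?A \<odot> ?B) ?j ?D \<Zsemi> (whisk \<I> (v_tensor C a a b c) (?A \<odot> ?D) \<Zsemi>
           (whisk (hom_obj C (v_prod C a b) (v_prod C a c)) (v_tensor C a a c d) \<I> \<Zsemi>
           v_comp C (v_prod C a b) (v_prod C a c) (v_prod C a d))))"
      using comp_eq_assoc[OF exchange[OF v_tensor_hom[of a a b c] v_ident_hom[of a], of \<I> \<I> ?D]]
      by (simp add: F tensor_whisk)
    also have "\<dots> = whisk \<I> ?j (?B \<odot> ?D) \<Zsemi> (whisk ?A ?j (?B \<odot> ?D) \<Zsemi>
        (whisk \<I> (v_comp C a a a) (?B \<odot> ?D) \<Zsemi>
        (whisk ?A (v_comp C b c d) \<I> \<Zsemi> v_tensor C a a b d)))"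
      using braided_interchange_whisk[of \<I> a a b c a d \<I>]
        comp_eq_assoc[OF braid_natural_right[OF v_ident_hom[of a], of ?A ?B ?D]]
      by simp
    \<comment> \<open>The two identity elements of \<open>a\<close> compose to one by the unit
      law.\<close>
    also have "\<dots> = whisk \<I> ?j (?B \<odot> ?D) \<Zsemi> (whisk ?A (v_comp C b c d) \<I> \<Zsemi> v_tensor C a a b d)"
      using comp_eq_assoc[OF v_ident_right_whisk[of \<I> a a "?B \<odot> ?D"]] by simp
    also have "\<dots> = v_comp C b c d \<Zsemi> f_hom ?F b d"
      using comp_eq_assoc[OF exchange[OF v_ident_hom[of a] v_comp_hom[of b c d], of \<I> \<I> \<I>]]
      by (simp add: F)
    finally show ?thesis ..
  qed
qed

end

section \<open>The completion\<close>

locale rigid_v_monoidal_category = braided_rigid_category V + v_monoidal_category V C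
  for V :: "('o, 'm) rigid_data" (structure)
    and C :: "('c, 'o, 'm) v_monoidal_data"
begin

abbreviation completion_cat ("\<CC>") where "\<CC> \<equiv> completion V C"

lemma completion_simps [simp]:
  "hom_obj \<CC> (a \<triangleleft> u) (b \<triangleleft> v) = u\<^sup>\<star> \<odot> hom_obj C a b \<odot> v"
  "v_ident \<CC> (a \<triangleleft> u) = coev V u \<Zsemi> whisk (u\<^sup>\<star>) (v_ident C a) u"
  "v_comp \<CC> (a \<triangleleft> u) (b \<triangleleft> v) (c \<triangleleft> w) =
     whisk (u\<^sup>\<star> \<odot> hom_obj C a b) (ev V v) (hom_obj C b c \<odot> w) \<Zsemi> whisk (u\<^sup>\<star>) (v_comp C a b c) w"
  "v_unit \<CC> = v_unit C \<triangleleft> \<I>"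
  "v_prod \<CC> (a \<triangleleft> u) (b \<triangleleft> v) = v_prod C a b \<triangleleft> (u \<odot> v)"
  "v_tensor \<CC> (a \<triangleleft> u) (c \<triangleleft> w) (b \<triangleleft> v) (d \<triangleleft> x) =
     whisk \<I> (ibraid (u\<^sup>\<star> \<odot> hom_obj C a c \<odot> w) (v\<^sup>\<star>)) (hom_obj C b d \<odot> x) \<Zsemi>
     (whisk (v\<^sup>\<star> \<odot> u\<^sup>\<star> \<odot> hom_obj C a c) (ibraid w (hom_obj C b d)) x \<Zsemi>
      whisk (v\<^sup>\<star> \<odot> u\<^sup>\<star>) (v_tensor C a c b d) (w \<odot> x))"
  by (simp_all add: completion_def ident_tensor_whisk tensor_ident_whisk ibraid_def[symmetric])

section \<open>The completion as an enriched category\<close>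

text \<open>The two evaluations act on disjoint strands and move ahead of the compositions of
  \<open>C\<close>, whose associativity remains.\<close>

lemma completion_v_comp_assoc:
  "(v_comp \<CC> a b c \<otimes> \<langle>hom_obj \<CC> c d\<rangle>) \<Zsemi> v_comp \<CC> a c d =
   (\<langle>hom_obj \<CC> a b\<rangle> \<otimes> v_comp \<CC> b c d) \<Zsemi> v_comp \<CC> a b d"
proof (cases a; cases b; cases c; cases d)
  fix a' u b' v c' w d' x
  assume eqs: "a = a' \<triangleleft> u" "b = b' \<triangleleft> v" "c = c' \<triangleleft> w" "d = d' \<triangleleft> x"
  let ?A = "hom_obj C a' b'" and ?B = "hom_obj C b' c'" and ?D = "hom_obj C c' d'"
  note e1 = exchange[OF v_comp_hom[of a' b' c'] ev_hom[of w], of "u\<^sup>\<star>" \<I> "?D \<odot> x", simplified]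
  note e2 = exchange[OF ev_hom[of v] v_comp_hom[of b' c' d'], of "u\<^sup>\<star> \<odot> ?A" \<I> x,
      simplified, symmetric]
  note e3 = exchange[OF ev_hom[of v] ev_hom[of w], of "u\<^sup>\<star> \<odot> ?A" ?B "?D \<odot> x", simplified]
  note assoc = v_comp_assoc_whisk[of "u\<^sup>\<star>" a' b' c' d' x]
  show ?thesis
    by (simp add: eqs ident_tensor_whisk tensor_ident_whisk comp_eq_assoc[OF e1]
        comp_eq_assoc[OF e2]
      comp_eq_assoc[OF e3] assoc)
qed

text \<open>The identity element of \<open>C\<close> slides past the evaluation; then coevaluation
  and evaluation straighten, and the unit law of \<open>C\<close> remains.\<close>

lemma completion_v_ident_left:
  "(v_ident \<CC> a \<otimes> \<langle>hom_obj \<CC> a b\<rangle>) \<Zsemi> v_comp \<CC> a a b = \<langle>hom_obj \<CC> a b\<rangle>"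
proof (cases a; cases b)
  fix a' u b' v
  assume eqs: "a = a' \<triangleleft> u" "b = b' \<triangleleft> v"
  let ?B = "hom_obj C a' b'"
  note e = exchange[OF v_ident_hom[of a'] ev_hom[of u], of "u\<^sup>\<star>" \<I> "?B \<odot> v", simplified]
  note z = zigzag_dual[of \<I> u "?B \<odot> v", simplified]
  show ?thesis
    using v_ident_left_whisk[of "u\<^sup>\<star>" a' b' v]
    by (simp add: eqs tensor_ident_whisk comp_eq_assoc[OF e] z)
qed

lemma completion_v_ident_right:
  "(\<langle>hom_obj \<CC> a b\<rangle> \<otimes> v_ident \<CC> b) \<Zsemi> v_comp \<CC> a b b = \<langle>hom_obj \<CC> a b\<rangle>"
proof (cases a; cases b)
  fix a' u b' v
  assume eqs: "a = a' \<triangleleft> u" "b = b' \<triangleleft> v"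
  let ?B = "hom_obj C a' b'"
  note e = exchange[OF ev_hom[of v] v_ident_hom[of b'], of "u\<^sup>\<star> \<odot> ?B" \<I> "v",
      simplified, symmetric]
  note z = zigzag[of "u\<^sup>\<star> \<odot> ?B" v \<I>, simplified]
  show ?thesis
    using v_ident_right_whisk[of "u\<^sup>\<star>" a' b' v]
    by (simp add: eqs ident_tensor_whisk comp_eq_assoc[OF e] z)
qed

lemma completion_v_category: "v_category V \<CC>"
proof unfold_locales
  show "v_ident \<CC> a \<in> hom V \<I> (hom_obj \<CC> a a)" for a
    by (cases a) (simp add: hom_def)
  show "v_comp \<CC> a b c \<in> hom V (hom_obj \<CC> a b \<odot> hom_obj \<CC> b c) (hom_obj \<CC> a c)" for a b c
    by (cases a; cases b; cases c) (simp add: hom_def)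
qed (fact completion_v_comp_assoc completion_v_ident_left completion_v_ident_right)+

section \<open>The monoidal structure of the completion\<close>

text \<open>On either side the inner tensor of \<open>C\<close> slides behind the crossings;
  \<open>shuffle_assoc\<close> compares the crossings, and associativity in \<open>C\<close> the
  rest.\<close>

lemma completion_v_tensor_assoc:
  "(v_tensor \<CC> a b c d \<otimes> \<langle>hom_obj \<CC> e f\<rangle>) \<Zsemi> v_tensor \<CC> (v_prod \<CC> a c) (v_prod \<CC> b d) e f =
   (\<langle>hom_obj \<CC> a b\<rangle> \<otimes> v_tensor \<CC> c d e f) \<Zsemi> v_tensor \<CC> a b (v_prod \<CC> c e) (v_prod \<CC> d f)"
proof (cases a; cases b; cases c; cases d; cases e; cases f)
  fix a' u b' w c' v d' x e' s f' y
  assume eqs: "a = a' \<triangleleft> u" "b = b' \<triangleleft> w" "c = c' \<triangleleft> v" "d = d' \<triangleleft> x" "e = e' \<triangleleft> s" "f = f' \<triangleleft> y"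
  let ?A = "hom_obj C a' b'" and ?B = "hom_obj C c' d'" and ?D = "hom_obj C e' f'"
  let ?E = "hom_obj C (v_prod C a' c') (v_prod C b' d')"
  have h: "whisk (v\<^sup>\<star> \<odot> u\<^sup>\<star>) (v_tensor C a' b' c' d') (w \<odot> x)
      \<in> hom V (v\<^sup>\<star> \<odot> u\<^sup>\<star> \<odot> ?A \<odot> ?B \<odot> w \<odot> x) (v\<^sup>\<star> \<odot> u\<^sup>\<star> \<odot> ?E \<odot> w \<odot> x)"
    by (simp add: hom_def)
  note l1 = ibraid_natural_left[OF h, of \<I> "s\<^sup>\<star>" "?D \<odot> y", simplified]
  note l2 = exchange[OF v_tensor_hom[of a' b' c' d'] ibraid_hom[of "w \<odot> x" ?D],
      of "s\<^sup>\<star> \<odot> v\<^sup>\<star> \<odot> u\<^sup>\<star>" \<I> y, simplified]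
  note r1 = exchange[OF ibraid_hom[of "u\<^sup>\<star> \<odot> ?A \<odot> w" "s\<^sup>\<star> \<odot> v\<^sup>\<star>"] v_tensor_hom[of c' d' e' f'],
      of \<I> \<I> "x \<odot> y", simplified, symmetric]
  note r2 = ibraid_natural_right[OF v_tensor_hom[of c' d' e' f'],
      of "s\<^sup>\<star> \<odot> v\<^sup>\<star> \<odot> u\<^sup>\<star> \<odot> ?A" w "x \<odot> y", simplified]
  \<comment> \<open>This tail of two tensors of \<open>C\<close> is appended to
    \<open>shuffle_assoc\<close> so that it speaks of the full diagrams.\<close>
  let ?T = "whisk (s\<^sup>\<star> \<odot> v\<^sup>\<star> \<odot> u\<^sup>\<star> \<odot> ?A) (v_tensor C c' d' e' f') (w \<odot> x \<odot> y) \<Zsemi>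
      whisk (s\<^sup>\<star> \<odot> v\<^sup>\<star> \<odot> u\<^sup>\<star>) (v_tensor C a' b' (v_prod C c' e') (v_prod C d' f')) (w \<odot> x \<odot> y)"
  show ?thesis
    using v_tensor_assoc_whisk[of "s\<^sup>\<star> \<odot> v\<^sup>\<star> \<odot> u\<^sup>\<star>" a' b' c' d' e' f' "w \<odot> x \<odot> y"]
      arg_cong[OF shuffle_assoc[of "u\<^sup>\<star>" ?A w "v\<^sup>\<star>" ?B x "s\<^sup>\<star>" ?D y], of "\<lambda>h. h \<Zsemi> ?T"]
    by (simp add: eqs dual_tensor v_prod_assoc ident_tensor_whisk tensor_ident_whisk
        comp_eq_assoc[OF l1] comp_eq_assoc[OF l2] comp_eq_assoc[OF r1] comp_eq_assoc[OF r2])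
qed

text \<open>The identity of the unit object starts at \<open>\<I>\<close>, so sliding it through the
  crossing makes the crossing trivial; the leftover \<open>coev V \<I>\<close> is absorbed by the
  neighbouring dual.\<close>

lemma completion_v_tensor_unit_left:
  "(v_ident \<CC> (v_unit \<CC>) \<otimes> \<langle>hom_obj \<CC> a b\<rangle>) \<Zsemi> v_tensor \<CC> (v_unit \<CC>) (v_unit \<CC>) a b =
   \<langle>hom_obj \<CC> a b\<rangle>"
proof (cases a; cases b)
  fix a' v b' x
  assume eqs: "a = a' \<triangleleft> v" "b = b' \<triangleleft> x"
  let ?B = "hom_obj C a' b'"
  have h: "coev V \<I> \<Zsemi> whisk (\<I>\<^sup>\<star>) (v_ident C (v_unit C)) \<I>
      \<in> hom V \<I> (\<I>\<^sup>\<star> \<odot> hom_obj C (v_unit C) (v_unit C))"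
    by (simp add: hom_def)
  note n = ibraid_natural_left[OF h, of \<I> "v\<^sup>\<star>" "?B \<odot> x", simplified]
  show ?thesis
    using v_tensor_unit_left_whisk[of "v\<^sup>\<star>" a' b' x]
    by (simp add: eqs tensor_ident_whisk comp_eq_assoc3[OF n] dual_unit coev_unit_whisk_right)
qed

lemma completion_v_tensor_unit_right:
  "(\<langle>hom_obj \<CC> a b\<rangle> \<otimes> v_ident \<CC> (v_unit \<CC>)) \<Zsemi> v_tensor \<CC> a b (v_unit \<CC>) (v_unit \<CC>) =
   \<langle>hom_obj \<CC> a b\<rangle>"
proof (cases a; cases b)
  fix a' u b' w
  assume eqs: "a = a' \<triangleleft> u" "b = b' \<triangleleft> w"
  let ?A = "hom_obj C a' b'"
  note e = exchange[OF ibraid_hom[of "u\<^sup>\<star> \<odot> ?A \<odot> w" "\<I>\<^sup>\<star>"] v_ident_hom[of "v_unit C"], of \<I> \<I> \<I>,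
      simplified, symmetric]
  note n2 = ibraid_natural_right[OF v_ident_hom[of "v_unit C"], of "u\<^sup>\<star> \<odot> ?A" w \<I>, simplified]
  \<comment> \<open>\<open>coev V \<I>\<close> reaches the far left without a crossing, and
    \<open>u\<^sup>\<star>\<close> absorbs it there.\<close>
  have c: "whisk (u\<^sup>\<star> \<odot> ?A \<odot> w) (coev V \<I>) \<I> \<Zsemi> ibraid (u\<^sup>\<star> \<odot> ?A \<odot> w) (\<I>\<^sup>\<star>) = \<langle>u\<^sup>\<star> \<odot> ?A \<odot> w\<rangle>"
    using ibraid_natural_right[OF coev_hom[of \<I>], of \<I> "u\<^sup>\<star> \<odot> ?A \<odot> w" \<I>]
    by (simp add: coev_unit_whisk_left)
  show ?thesis
    using v_tensor_unit_right_whisk[of "u\<^sup>\<star>" a' b' w]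
    by (simp add: eqs ident_tensor_whisk comp_eq_assoc[OF e] c comp_eq_assoc[OF c]
        comp_eq_assoc[OF n2] dual_unit)
qed

lemma completion_v_tensor_ident:
  "(v_ident \<CC> a \<otimes> v_ident \<CC> b) \<Zsemi> v_tensor \<CC> a a b b = v_ident \<CC> (v_prod \<CC> a b)"
proof (cases a; cases b)
  fix a' u b' v
  assume eqs: "a = a' \<triangleleft> u" "b = b' \<triangleleft> v"
  let ?A = "hom_obj C a' a'" and ?B = "hom_obj C b' b'"
  have h: "coev V u \<Zsemi> whisk (u\<^sup>\<star>) (v_ident C a') u \<in> hom V \<I> (u\<^sup>\<star> \<odot> ?A \<odot> u)"
    by (simp add: hom_def)
  note n1 = ibraid_natural_left[OF h, of \<I> "v\<^sup>\<star>" "?B \<odot> v", simplified]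
  note n2 = ibraid_natural_right[OF v_ident_hom[of b'], of "v\<^sup>\<star> \<odot> u\<^sup>\<star> \<odot> ?A" u v, simplified]
  note e1 = exchange[OF coev_hom[of u] v_ident_hom[of b'], of "v\<^sup>\<star>" \<I> v, simplified, symmetric]
  note e2 = exchange[OF v_ident_hom[of a'] v_ident_hom[of b'], of "v\<^sup>\<star> \<odot> u\<^sup>\<star>" u v,
      simplified, symmetric]
  \<comment> \<open>\<open>tensor_whisk'\<close> puts the second factor first, so
    \<open>coev V v\<close> is outermost, as in \<open>coev_tensor\<close>.\<close>
  show ?thesis
    using v_tensor_ident_whisk[of "v\<^sup>\<star> \<odot> u\<^sup>\<star>" a' "u \<odot> v" b'] coev_tensor[of u v]
    by (simp add: eqs tensor_whisk' comp_eq_assoc3[OF n1] comp_eq_assoc[OF n2]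
        comp_eq_assoc[OF e1]
        comp_eq_assoc[OF e2] dual_tensor ident_tensor_ident_whisk)
qed

text \<open>The tensors of \<open>C\<close> on the left (\<open>l1\<close> to \<open>l6\<close>) and
  the compositions of \<open>C\<close> on the right (\<open>r1\<close> to \<open>r5\<close>) slide
  behind crossings and evaluations. \<open>shuffle_interchange\<close> then leaves one extra
  crossing of hom objects, which the interchange law of \<open>C\<close> accounts for.\<close>

lemma completion_braided_interchange:
  "(v_tensor \<CC> a b d e \<otimes> v_tensor \<CC> b c e f) \<Zsemi>
     v_comp \<CC> (v_prod \<CC> a d) (v_prod \<CC> b e) (v_prod \<CC> c f) =
   (\<langle>hom_obj \<CC> a b\<rangle> \<otimes> \<beta> (hom_obj \<CC> d e) (hom_obj \<CC> b c) \<otimes> \<langle>hom_obj \<CC> e f\<rangle>) \<Zsemi>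
     (v_comp \<CC> a b c \<otimes> v_comp \<CC> d e f) \<Zsemi> v_tensor \<CC> a c d f"
proof (cases a; cases b; cases c; cases d; cases e; cases f)
  fix a' u b' w c' y d' v e' x f' z
  assume eqs: "a = a' \<triangleleft> u" "b = b' \<triangleleft> w" "c = c' \<triangleleft> y" "d = d' \<triangleleft> v" "e = e' \<triangleleft> x" "f = f' \<triangleleft> z"
  let ?A = "hom_obj C a' b'" and ?A' = "hom_obj C b' c'" and ?G = "hom_obj C a' c'"
  let ?B = "hom_obj C d' e'" and ?B' = "hom_obj C e' f'"
  let ?P = "hom_obj C (v_prod C a' d') (v_prod C b' e')"
  let ?m = "v_comp C a' b' c'" and ?m' = "v_comp C d' e' f'"
  note T = v_tensor_hom[of a' b' d' e'] and T' = v_tensor_hom[of b' c' e' f']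
    and m = v_comp_hom[of a' b' c'] and m' = v_comp_hom[of d' e' f']
  \<comment> \<open>\<open>?K\<close> is the end of both diagrams once the interchange law of
    \<open>C\<close> has been applied on the left.\<close>
  let ?K = "whisk (v\<^sup>\<star> \<odot> u\<^sup>\<star>) ?m (?B \<odot> ?B' \<odot> y \<odot> z) \<Zsemi>
    (whisk (v\<^sup>\<star> \<odot> u\<^sup>\<star> \<odot> ?G) ?m' (y \<odot> z) \<Zsemi> whisk (v\<^sup>\<star> \<odot> u\<^sup>\<star>) (v_tensor C a' c' d' f') (y \<odot> z))"
  note l1 = exchange[OF T ibraid_hom[of "w\<^sup>\<star> \<odot> ?A' \<odot> y" "x\<^sup>\<star>"],
      of "v\<^sup>\<star> \<odot> u\<^sup>\<star>" "w \<odot> x" "?B' \<odot> z", simplified]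
  note l2 = exchange[OF T ibraid_hom[of y ?B'],
      of "v\<^sup>\<star> \<odot> u\<^sup>\<star>" "w \<odot> x \<odot> x\<^sup>\<star> \<odot> w\<^sup>\<star> \<odot> ?A'" z, simplified]
  note l3 = exchange[OF T ev_hom[of x],
      of "v\<^sup>\<star> \<odot> u\<^sup>\<star>" w "w\<^sup>\<star> \<odot> ?A' \<odot> ?B' \<odot> y \<odot> z", simplified]
  note l4 = exchange[OF T ev_hom[of w],
      of "v\<^sup>\<star> \<odot> u\<^sup>\<star>" \<I> "?A' \<odot> ?B' \<odot> y \<odot> z", simplified]
  note l5 = exchange[OF ev_hom[of x] T',
      of "v\<^sup>\<star> \<odot> u\<^sup>\<star> \<odot> ?P \<odot> w" "w\<^sup>\<star>" "y \<odot> z", simplified, symmetric]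
  note l6 = exchange[OF ev_hom[of w] T',
      of "v\<^sup>\<star> \<odot> u\<^sup>\<star> \<odot> ?P" \<I> "y \<odot> z", simplified, symmetric]
  have h: "whisk (u\<^sup>\<star>) ?m y \<in> hom V (u\<^sup>\<star> \<odot> ?A \<odot> ?A' \<odot> y) (u\<^sup>\<star> \<odot> ?G \<odot> y)"
    by (simp add: hom_def)
  note r1 = exchange[OF m ev_hom[of x],
      of "u\<^sup>\<star>" "y \<odot> v\<^sup>\<star> \<odot> ?B" "?B' \<odot> z", simplified]
  note r2 = exchange[OF ibraid_hom[of "u\<^sup>\<star> \<odot> ?G \<odot> y" "v\<^sup>\<star>"] m', of \<I> \<I> z, simplified, symmetric]
  note r3 = ibraid_natural_left[OF h, of \<I> "v\<^sup>\<star>" "?B \<odot> ?B' \<odot> z", simplified]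
  note r4 = ibraid_natural_right[OF m', of "v\<^sup>\<star> \<odot> u\<^sup>\<star> \<odot> ?G" y z, simplified]
  note r5 = exchange[OF m ibraid_hom[of y "?B \<odot> ?B'"], of "v\<^sup>\<star> \<odot> u\<^sup>\<star>" \<I> z, simplified]
  show ?thesis
    using braided_interchange_whisk[of "v\<^sup>\<star> \<odot> u\<^sup>\<star>" a' b' d' e' c' f' "y \<odot> z"]
      arg_cong[OF shuffle_interchange[of "u\<^sup>\<star>" ?A w "v\<^sup>\<star>" ?B x ?A' y ?B' z], of "\<lambda>h. h \<Zsemi> ?K"]
    by (simp add: eqs dual_tensor ev_tensor ident_tensor_ident_whisk tensor_whisk
        comp_eq_assoc[OF l1] comp_eq_assoc[OF l2] comp_eq_assoc[OF l3] comp_eq_assoc[OF l4]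
        comp_eq_assoc[OF l5] comp_eq_assoc[OF l6] comp_eq_assoc[OF r1] comp_eq_assoc[OF r2]
        comp_eq_assoc[OF r3] comp_eq_assoc[OF r4] comp_eq_assoc[OF r5])
qed

lemma completion_v_monoidal_category: "v_monoidal_category V \<CC>"
proof (intro v_monoidal_category.intro v_monoidal_category_axioms.intro)
  show "v_prod \<CC> (v_prod \<CC> a b) c = v_prod \<CC> a (v_prod \<CC> b c)" for a b c
    by (cases a; cases b; cases c) (simp add: v_prod_assoc)
  show "v_prod \<CC> (v_unit \<CC>) a = a" "v_prod \<CC> a (v_unit \<CC>) = a" for a
    by (cases a; simp add: v_unit_left v_unit_right)+
  show "v_tensor \<CC> a b c d \<in>
      hom V (hom_obj \<CC> a b \<odot> hom_obj \<CC> c d) (hom_obj \<CC> (v_prod \<CC> a c) (v_prod \<CC> b d))" for a b c d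
    by (cases a; cases b; cases c; cases d) (simp add: hom_def dual_tensor)
qed (fact braided_monoidal_category_axioms completion_v_category completion_v_tensor_assoc
    completion_v_tensor_unit_left completion_v_tensor_unit_right completion_v_tensor_ident
    completion_braided_interchange)+

end

section \<open>The internal hom of the completion\<close>

text \<open>Closedness only asserts that right adjoints exist; fixing a choice \<open>H\<close>,
  \<open>\<theta>\<close> lets the formulas for the completion refer to it.\<close>

locale rigid_v_closed_category = rigid_v_monoidal_category V C
  for V :: "('o, 'm) rigid_data" (structure)
    and C :: "('c, 'o, 'm) v_monoidal_data" +
  fixes H :: "'c \<Rightarrow> ('c, 'c, 'm) v_functor_data"
    and \<theta> :: "'c \<Rightarrow> 'c \<Rightarrow> 'c \<Rightarrow> 'm"
  assumes adjunction: "v_adjunction V C C (tensor_left V C a) (H a) (\<theta> a)"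
begin

abbreviation L_hom ("\<L>") where "\<L> a b c \<equiv> f_hom (tensor_left V C a) b c"
abbreviation R_hom ("\<H>") where "\<H> a b c \<equiv> f_hom (H a) b c"
abbreviation R_obj ("\<lbrakk>_,_\<rbrakk>") where "\<lbrakk>a, b\<rbrakk> \<equiv> f_obj (H a) b"
abbreviation theta_inv where "theta_inv a b c \<equiv> arr_inv V (\<theta> a b c)"

lemmas right_v_functor = v_adjunction.axioms(2)[OF adjunction]

lemma f_obj_tensor_left [simp]: "f_obj (tensor_left V C a) b = v_prod C a b"
  by (simp add: tensor_left_def)

lemma L_hom_hom: "\<L> a b c \<in> hom V (hom_obj C b c) (hom_obj C (v_prod C a b) (v_prod C a c))"
  using v_functor.f_hom_hom[OF tensor_left_v_functor[of a], of b c] by simp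

lemma R_hom_hom: "\<H> a b c \<in> hom V (hom_obj C b c) (hom_obj C \<lbrakk>a, b\<rbrakk> \<lbrakk>a, c\<rbrakk>)"
  by (rule v_functor.f_hom_hom[OF right_v_functor])

lemma theta_hom: "\<theta> a b c \<in> hom V (hom_obj C (v_prod C a b) c) (hom_obj C b \<lbrakk>a, c\<rbrakk>)"
  using v_adjunction.theta_hom[OF adjunction, of a b c] by simp

lemma inverse_arrows_theta: "inverse_arrows V (\<theta> a b c) (theta_inv a b c)"
  by (rule inverse_arrows_arr_inv[OF v_adjunction.theta_iso[OF adjunction]])

lemma theta_inv_hom: "theta_inv a b c \<in> hom V (hom_obj C b \<lbrakk>a, c\<rbrakk>) (hom_obj C (v_prod C a b) c)"
  using inverse_arrows_theta[of a b c] theta_hom[of a b c] by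
      (simp add: hom_def inverse_arrows_def)

lemmas adjunction_arrow_simps [simp] =
  L_hom_hom[THEN src_hom] L_hom_hom[THEN tgt_hom] R_hom_hom[THEN src_hom] R_hom_hom[THEN tgt_hom]
  theta_hom[THEN src_hom] theta_hom[THEN tgt_hom]
      theta_inv_hom[THEN src_hom] theta_inv_hom[THEN tgt_hom]

lemma R_hom_comp_whisk:
  "whisk L (v_comp C b c d) R \<Zsemi> whisk L (\<H> a b d) R
   = whisk L (\<H> a b c) (hom_obj C c d \<odot> R) \<Zsemi>
     (whisk (L \<odot> hom_obj C \<lbrakk>a, b\<rbrakk> \<lbrakk>a, c\<rbrakk>) (\<H> a c d) R \<Zsemi>
      whisk L (v_comp C \<lbrakk>a, b\<rbrakk> \<lbrakk>a, c\<rbrakk> \<lbrakk>a, d\<rbrakk>) R)"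
  using arg_cong[OF v_functor.f_hom_comp[OF right_v_functor, of b c d a], of "\<lambda>h. whisk L h R"]
  by (simp add: tensor_whisk)

lemma R_hom_ident_whisk:
  "whisk L (v_ident C b) R \<Zsemi> whisk L (\<H> a b b) R = whisk L (v_ident C \<lbrakk>a, b\<rbrakk>) R"
  using arg_cong[OF v_functor.f_hom_ident[OF right_v_functor, of b a], of "\<lambda>h. whisk L h R"]
  by simp

lemma theta_natural_left_whisk:
  "whisk L (v_comp C b b' \<lbrakk>a, c\<rbrakk>) R \<Zsemi> whisk L (theta_inv a b c) R
   = whisk L (\<L> a b b') (hom_obj C b' \<lbrakk>a, c\<rbrakk> \<odot> R) \<Zsemi>
     (whisk (L \<odot> hom_obj C (v_prod C a b) (v_prod C a b')) (theta_inv a b' c) R \<Zsemi>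
      whisk L (v_comp C (v_prod C a b) (v_prod C a b') c) R)"
  using arg_cong[OF v_adjunction.theta_natural_left[OF adjunction, of b b' a c],
      of "\<lambda>h. whisk L h R"]
  by (simp add: tensor_whisk)

lemma theta_natural_right_whisk:
  "whisk L (v_comp C (v_prod C a b) c d) R \<Zsemi> whisk L (\<theta> a b d) R
   = whisk L (\<theta> a b c) (hom_obj C c d \<odot> R) \<Zsemi>
     (whisk (L \<odot> hom_obj C b \<lbrakk>a, c\<rbrakk>) (\<H> a c d) R \<Zsemi>
      whisk L (v_comp C b \<lbrakk>a, c\<rbrakk> \<lbrakk>a, d\<rbrakk>) R)"
  using arg_cong[OF v_adjunction.theta_natural_right[OF adjunction, of a b c d],
      of "\<lambda>h. whisk L h R"]
  by (simp add: tensor_whisk)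

abbreviation completion_hom ("\<HH>") where "\<HH> \<equiv> completion_internal_hom V C H"

lemma completion_internal_hom_simps [simp]:
  "f_obj (\<HH> (a \<triangleleft> u)) (b \<triangleleft> v) = \<lbrakk>a, b\<rbrakk> \<triangleleft> (u\<^sup>\<star> \<odot> v)"
  "f_hom (\<HH> (a \<triangleleft> u)) (b \<triangleleft> v) (c \<triangleleft> w) =
     whisk (v\<^sup>\<star>) (\<H> a b c) w \<Zsemi>
     (whisk (v\<^sup>\<star>) (coev V (u\<^sup>\<star>)) (hom_obj C \<lbrakk>a, b\<rbrakk> \<lbrakk>a, c\<rbrakk> \<odot> w) \<Zsemi>
      whisk (v\<^sup>\<star> \<odot> (u\<^sup>\<star>)\<^sup>\<star>) (ibraid (u\<^sup>\<star>) (hom_obj C \<lbrakk>a, b\<rbrakk> \<lbrakk>a, c\<rbrakk>)) w)"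
  by (simp_all add: completion_internal_hom_def ident_tensor_ident_whisk ibraid_def[symmetric])

text \<open>The composition after the functor evaluates at a product with
  \<open>u\<^sup>\<star>\<close>, so a nested pair of evaluations occurs. The one at
  \<open>u\<^sup>\<star>\<close> straightens against the second coevaluation; the two remaining
  crossings form, by the hexagon, the crossing with a product of hom objects.\<close>

lemma completion_internal_hom_comp:
  "v_comp \<CC> b c d \<Zsemi> f_hom (\<HH> x) b d =
   (f_hom (\<HH> x) b c \<otimes> f_hom (\<HH> x) c d) \<Zsemi> v_comp \<CC> (f_obj (\<HH> x) b) (f_obj (\<HH> x) c) (f_obj (\<HH> x) d)"
proof (cases x; cases b; cases c; cases d)
  fix a u b' v c' w d' y
  assume eqs: "x = a \<triangleleft> u" "b = b' \<triangleleft> v" "c = c' \<triangleleft> w" "d = d' \<triangleleft> y"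
  let ?A = "hom_obj C b' c'" and ?A' = "hom_obj C \<lbrakk>a, b'\<rbrakk> \<lbrakk>a, c'\<rbrakk>"
  let ?B = "hom_obj C c' d'" and ?B' = "hom_obj C \<lbrakk>a, c'\<rbrakk> \<lbrakk>a, d'\<rbrakk>"
  let ?m' = "v_comp C \<lbrakk>a, b'\<rbrakk> \<lbrakk>a, c'\<rbrakk> \<lbrakk>a, d'\<rbrakk>" and ?d = "u\<^sup>\<star>" and ?dd = "(u\<^sup>\<star>)\<^sup>\<star>"
  let ?L = "v\<^sup>\<star> \<odot> ?dd \<odot> ?A'"
  note m' = v_comp_hom[of "\<lbrakk>a, b'\<rbrakk>" "\<lbrakk>a, c'\<rbrakk>" "\<lbrakk>a, d'\<rbrakk>"]
  note ww = ev_hom[of w] and dd = ev_hom[of ?d] and F = R_hom_hom[of a b' c'] and F'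
      = R_hom_hom[of a c' d']
  note l1 = exchange[OF coev_hom[of ?d] m', of "v\<^sup>\<star>" \<I> y, simplified, symmetric]
  note l2 = ibraid_natural_right[OF m', of "v\<^sup>\<star> \<odot> ?dd" ?d y, simplified]
  have lhs: "v_comp \<CC> b c d \<Zsemi> f_hom (\<HH> x) b d =
      whisk (v\<^sup>\<star> \<odot> ?A) (ev V w) (?B \<odot> y) \<Zsemi> (whisk (v\<^sup>\<star>) (\<H> a b' c') (?B \<odot> y) \<Zsemi>
      (whisk (v\<^sup>\<star> \<odot> ?A') (\<H> a c' d') y \<Zsemi> (whisk (v\<^sup>\<star>) (coev V ?d) (?A' \<odot> ?B' \<odot> y) \<Zsemi>
      (whisk (v\<^sup>\<star> \<odot> ?dd) (ibraid ?d ?A') (?B' \<odot> y) \<Zsemi> (whisk ?L (ibraid ?d ?B') y \<Zsemi>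
       whisk (v\<^sup>\<star> \<odot> ?dd) ?m' (?d \<odot> y))))))"
    by (simp add: eqs comp_eq_assoc[OF R_hom_comp_whisk]
        comp_eq_assoc[OF l1] l2 ibraid_tensor_right)
  \<comment> \<open>\<open>r1\<close> to \<open>r6\<close> bring \<open>ev V w\<close> to the front,
    \<open>r7\<close> and \<open>r8\<close> move \<open>\<H> a c' d'\<close> ahead of the first
    crossing and coevaluation, and \<open>r9\<close> brings \<open>ev V ?d\<close> next to the
    second coevaluation.\<close>
  note r1 = exchange[OF ww ibraid_hom[of ?d ?B'], of "?L \<odot> ?d" "?dd" y, simplified, symmetric]
  note r2 = exchange[OF ww coev_hom[of ?d], of "?L \<odot> ?d" \<I> "?B' \<odot> y", simplified, symmetric]
  note r3 = exchange[OF ww F', of "?L \<odot> ?d" \<I> y, simplified, symmetric]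
  note r4 = exchange[OF ibraid_hom[of ?d ?A'] ww, of "v\<^sup>\<star> \<odot> ?dd" \<I> "?B \<odot> y", simplified]
  note r5 = exchange[OF coev_hom[of ?d] ww, of "v\<^sup>\<star>" ?A' "?B \<odot> y", simplified]
  note r6 = exchange[OF F ww, of "v\<^sup>\<star>" \<I> "?B \<odot> y", simplified]
  note r7 = exchange[OF ibraid_hom[of ?d ?A'] F', of "v\<^sup>\<star> \<odot> ?dd" \<I> y, simplified]
  note r8 = exchange[OF coev_hom[of ?d] F', of "v\<^sup>\<star>" ?A' y, simplified]
  note r9 = exchange[OF dd ibraid_hom[of ?d ?B'], of ?L \<I> y, simplified, symmetric]
  note z = zigzag[of ?L ?d "?B' \<odot> y", simplified]
  show ?thesis
    unfolding lhs
    by (simp add: eqs dual_tensor ev_tensor ident_tensor_ident_whisk tensor_whisk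
        comp_eq_assoc[OF r1] comp_eq_assoc[OF r2] comp_eq_assoc[OF r3] comp_eq_assoc[OF r4]
        comp_eq_assoc[OF r5] comp_eq_assoc[OF r6] comp_eq_assoc[OF r7] comp_eq_assoc[OF r8]
        comp_eq_assoc[OF r9] comp_eq_assoc[OF z])
qed

text \<open>By \<open>coev_tensor\<close> the coevaluation of the target object is nested from the
  given one and the one inserted by the functor; the identity of \<open>C\<close> makes the crossing
  trivial.\<close>

lemma completion_internal_hom_ident:
  "v_ident \<CC> b \<Zsemi> f_hom (\<HH> x) b b = v_ident \<CC> (f_obj (\<HH> x) b)"
proof (cases x; cases b)
  fix a u b' v
  assume eqs: "x = a \<triangleleft> u" "b = b' \<triangleleft> v"
  note j = v_ident_hom[of "\<lbrakk>a, b'\<rbrakk>"]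
  note e = exchange[OF coev_hom[of "u\<^sup>\<star>"] j, of "v\<^sup>\<star>" \<I> v, simplified, symmetric]
  note n = ibraid_natural_right[OF j, of "v\<^sup>\<star> \<odot> (u\<^sup>\<star>)\<^sup>\<star>" "u\<^sup>\<star>" v, simplified]
  show ?thesis
    by (simp add: eqs dual_tensor coev_tensor ident_tensor_ident_whisk
        comp_eq_assoc[OF R_hom_ident_whisk] comp_eq_assoc[OF e] n)
qed

lemma completion_internal_hom_v_functor: "v_functor V \<CC> \<CC> (\<HH> x)"
proof (intro v_functor.intro v_functor_axioms.intro completion_v_category)
  show "f_hom (\<HH> x) b c \<in> hom V (hom_obj \<CC> b c)
      (hom_obj \<CC> (f_obj (\<HH> x) b) (f_obj (\<HH> x) c))" for b c
    by (cases x; cases b; cases c) (simp add: hom_def dual_tensor)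
qed (fact completion_internal_hom_comp completion_internal_hom_ident)+

section \<open>The adjunction isomorphism of the completion\<close>

abbreviation completion_\<theta> ("\<Theta>") where "\<Theta> \<equiv> completion_theta V C \<theta>"

lemma completion_theta_whisk [simp]:
  "\<Theta> (a \<triangleleft> u) (b \<triangleleft> v) (c \<triangleleft> w) =
   whisk (v\<^sup>\<star>) (ibraid (u\<^sup>\<star>) (hom_obj C (v_prod C a b) c)) w \<Zsemi> whisk (v\<^sup>\<star>) (\<theta> a b c) (u\<^sup>\<star> \<odot> w)"
  by (simp add: ident_tensor_whisk tensor_ident_whisk ibraid_def[symmetric])

declare completion_theta.simps [simp del]

text \<open>Inversion reverses the two layers and turns the inverse crossing back into
  \<open>\<beta>\<close>.\<close>

lemma inverse_arrows_completion_theta: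
  "inverse_arrows V (\<Theta> (a \<triangleleft> u) (b \<triangleleft> v) (c \<triangleleft> w))
    (whisk (v\<^sup>\<star>) (theta_inv a b c) (u\<^sup>\<star> \<odot> w) \<Zsemi>
     whisk (v\<^sup>\<star>) (\<beta> (hom_obj C (v_prod C a b) c) (u\<^sup>\<star>)) w)"
  unfolding completion_theta_whisk
  by (intro inverse_arrows_comp inverse_arrows_whisk inverse_arrows_theta
      inverse_arrows_sym[OF inverse_arrows_braid]) simp

text \<open>As in \<open>completion_internal_hom_comp\<close>, the inserted coevaluation straightens
  against the evaluation at \<open>u\<^sup>\<star>\<close>; naturality of \<open>\<theta>\<close>
  and of the crossing does the rest.\<close>

lemma completion_theta_natural_right:
  "v_comp \<CC> (v_prod \<CC> x b) c d \<Zsemi> \<Theta> x b d =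
   (\<Theta> x b c \<otimes> f_hom (\<HH> x) c d) \<Zsemi> v_comp \<CC> b (f_obj (\<HH> x) c) (f_obj (\<HH> x) d)"
proof (cases x; cases b; cases c; cases d)
  fix a u b' v c' w d' y
  assume eqs: "x = a \<triangleleft> u" "b = b' \<triangleleft> v" "c = c' \<triangleleft> w" "d = d' \<triangleleft> y"
  let ?X = "hom_obj C (v_prod C a b') c'" and ?Y = "hom_obj C b' \<lbrakk>a, c'\<rbrakk>"
  let ?B = "hom_obj C c' d'" and ?B' = "hom_obj C \<lbrakk>a, c'\<rbrakk> \<lbrakk>a, d'\<rbrakk>"
  let ?d = "u\<^sup>\<star>" and ?dd = "(u\<^sup>\<star>)\<^sup>\<star>"
  let ?L = "v\<^sup>\<star> \<odot> ?Y"
  note ww = ev_hom[of w] and dd = ev_hom[of ?d] and R = R_hom_hom[of a c' d'] and t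
      = theta_hom[of a b' c']
  note l = ibraid_natural_right[OF v_comp_hom[of "v_prod C a b'" c' d'], of "v\<^sup>\<star>" ?d y,
      simplified]
  have lhs: "v_comp \<CC> (v_prod \<CC> x b) c d \<Zsemi> \<Theta> x b d =
      whisk (v\<^sup>\<star> \<odot> ?d \<odot> ?X) (ev V w) (?B \<odot> y) \<Zsemi> (whisk (v\<^sup>\<star>) (ibraid ?d ?X) (?B \<odot> y) \<Zsemi>
      (whisk (v\<^sup>\<star> \<odot> ?X) (ibraid ?d ?B) y \<Zsemi> (whisk (v\<^sup>\<star>) (\<theta> a b' c') (?B \<odot> ?d \<odot> y) \<Zsemi>
      (whisk ?L (\<H> a c' d') (?d \<odot> y) \<Zsemi>
       whisk (v\<^sup>\<star>) (v_comp C b' \<lbrakk>a, c'\<rbrakk> \<lbrakk>a, d'\<rbrakk>) (?d \<odot> y)))))"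
    by (simp add: eqs dual_tensor
        comp_eq_assoc[OF l] theta_natural_right_whisk ibraid_tensor_right)
  note r1 = exchange[OF ww ibraid_hom[of ?d ?B'], of "?L \<odot> ?d" "?dd" y, simplified, symmetric]
  note r2 = exchange[OF ww coev_hom[of ?d], of "?L \<odot> ?d" \<I> "?B' \<odot> y", simplified, symmetric]
  note r3 = exchange[OF ww R, of "?L \<odot> ?d" \<I> y, simplified, symmetric]
  note r4 = exchange[OF t ww, of "v\<^sup>\<star>" ?d "?B \<odot> y", simplified]
  note r5 = exchange[OF ibraid_hom[of ?d ?X] ww, of "v\<^sup>\<star>" \<I> "?B \<odot> y", simplified]
  note r6 = exchange[OF dd ibraid_hom[of ?d ?B'], of ?L \<I> y, simplified, symmetric]
  note z = zigzag[of ?L ?d "?B' \<odot> y", simplified]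
  note r7 = ibraid_natural_right[OF R, of ?L ?d y, simplified]
  note r8 = exchange[OF t ibraid_hom[of ?d ?B], of "v\<^sup>\<star>" \<I> y, simplified]
  show ?thesis
    unfolding lhs
    by (simp add: eqs dual_tensor ev_tensor ident_tensor_ident_whisk tensor_whisk
        comp_eq_assoc[OF r1] comp_eq_assoc[OF r2] comp_eq_assoc[OF r3] comp_eq_assoc[OF r4]
        comp_eq_assoc[OF r5] comp_eq_assoc[OF r6] comp_eq_assoc[OF r7] comp_eq_assoc[OF r8]
        comp_eq_assoc[OF z])
qed

text \<open>The identity of \<open>a \<triangleleft> u\<close> starts at \<open>\<I>\<close>, so its
  crossing with \<open>v\<^sup>\<star>\<close> is trivial; the identity of \<open>a\<close> joins
  the tensor of \<open>C\<close> to form \<open>\<L>\<close>, and only the crossing of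
  \<open>u\<close> with the hom object is left.\<close>

lemma completion_tensor_left_hom:
  "f_hom (tensor_left V \<CC> (a \<triangleleft> u)) (b \<triangleleft> v) (c \<triangleleft> x) =
   whisk (v\<^sup>\<star>) (coev V u) (hom_obj C b c \<odot> x) \<Zsemi>
   (whisk (v\<^sup>\<star> \<odot> u\<^sup>\<star>) (ibraid u (hom_obj C b c)) x \<Zsemi>
    whisk (v\<^sup>\<star> \<odot> u\<^sup>\<star>) (\<L> a b c) (u \<odot> x))"
proof -
  let ?A = "hom_obj C b c"
  have h: "coev V u \<Zsemi> whisk (u\<^sup>\<star>) (v_ident C a) u \<in> hom V \<I> (u\<^sup>\<star> \<odot> hom_obj C a a \<odot> u)"
    by (simp add: hom_def)
  note n = ibraid_natural_left[OF h, of \<I> "v\<^sup>\<star>" "?A \<odot> x", simplified]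
  note e = exchange[OF v_ident_hom[of a] ibraid_hom[of u ?A], of "v\<^sup>\<star> \<odot> u\<^sup>\<star>" \<I> x, simplified]
  show ?thesis
    by (simp add: tensor_left_def tensor_ident_whisk comp_eq_assoc3[OF n] comp_eq_assoc[OF e])
qed

lemma completion_theta_natural_left:
  "v_comp \<CC> b b' (f_obj (\<HH> x) c) \<Zsemi> arr_inv V (\<Theta> x b c) =
   (f_hom (tensor_left V \<CC> x) b b' \<otimes> arr_inv V (\<Theta> x b' c)) \<Zsemi>
     v_comp \<CC> (v_prod \<CC> x b) (v_prod \<CC> x b') c"
proof (cases x; cases b; cases b'; cases c)
  fix a u b1 v b2 y c' w
  assume eqs: "x = a \<triangleleft> u" "b = b1 \<triangleleft> v" "b' = b2 \<triangleleft> y" "c = c' \<triangleleft> w"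
  let ?A = "hom_obj C b1 b2" and ?Y = "hom_obj C b2 \<lbrakk>a, c'\<rbrakk>" and ?d = "u\<^sup>\<star>"
  let ?LA = "hom_obj C (v_prod C a b1) (v_prod C a b2)" and ?X = "hom_obj C (v_prod C a b2) c'"
  let ?m' = "v_comp C (v_prod C a b1) (v_prod C a b2) c'"
  note yy = ev_hom[of y] and uu = ev_hom[of u] and L = L_hom_hom[of a b1 b2]
    and t = theta_inv_hom[of a b2 c']
  \<comment> \<open>Both sides reduce to \<open>?nf\<close>. Its crossing
    \<open>\<beta> ?A ?d\<close> comes on the left from the inverse of \<open>\<Theta>\<close>, and
    on the right from the inverse crossing in the tensor functor.\<close>
  let ?nf = "whisk (v\<^sup>\<star> \<odot> ?A) (ev V y) (?Y \<odot> ?d \<odot> w) \<Zsemi>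
      (whisk (v\<^sup>\<star> \<odot> ?A) (theta_inv a b2 c') (?d \<odot> w) \<Zsemi>
      (whisk (v\<^sup>\<star> \<odot> ?A) (\<beta> ?X ?d) w \<Zsemi> (whisk (v\<^sup>\<star>) (\<beta> ?A ?d) (?X \<odot> w) \<Zsemi>
      (whisk (v\<^sup>\<star> \<odot> ?d) (\<L> a b1 b2) (?X \<odot> w) \<Zsemi> whisk (v\<^sup>\<star> \<odot> ?d) ?m' w))))"
  note l1 = braid_natural_left[OF v_comp_hom[of "v_prod C a b1" "v_prod C a b2" c'],
      of "v\<^sup>\<star>" ?d w, simplified]
  note l2 = exchange[OF L t, of "v\<^sup>\<star>" \<I> "?d \<odot> w", simplified]
  note l3 = exchange[OF L braid_hom[of ?X ?d], of "v\<^sup>\<star>" \<I> w, simplified]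
  note l4 = braid_natural_left[OF L, of "v\<^sup>\<star>" ?d "?X \<odot> w", simplified]
  \<comment> \<open>\<open>\<Theta>\<close> has to stay folded, since the formula for its inverse
    rewrites \<open>arr_inv V\<close> of the folded term.\<close>
  have lhs: "v_comp \<CC> b b' (f_obj (\<HH> x) c) \<Zsemi> arr_inv V (\<Theta> x b c) = ?nf"
    by (simp add: eqs arr_inv_eq[OF inverse_arrows_completion_theta] 
        comp_eq_assoc[OF theta_natural_left_whisk] l1 braid_tensor_left comp_eq_assoc[OF l2]
        comp_eq_assoc[OF l3] comp_eq_assoc[OF l4] del: completion_theta_whisk)
  let ?P = "v\<^sup>\<star> \<odot> ?d"
  note r1 = exchange[OF yy braid_hom[of ?X ?d], of "?P \<odot> ?LA \<odot> u" \<I> w, simplified, symmetric]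
  note r2 = exchange[OF yy t, of "?P \<odot> ?LA \<odot> u" \<I> "?d \<odot> w", simplified, symmetric]
  note r3 = exchange[OF L yy, of ?P u "?Y \<odot> ?d \<odot> w", simplified]
  note r4 = exchange[OF ibraid_hom[of u ?A] yy, of ?P \<I> "?Y \<odot> ?d \<odot> w", simplified]
  note r5 = exchange[OF coev_hom[of u] yy, of "v\<^sup>\<star>" ?A "?Y \<odot> ?d \<odot> w", simplified]
  note r6 = exchange[OF L t, of ?P u "?d \<odot> w", simplified]
  note r7 = exchange[OF L braid_hom[of ?X ?d], of ?P u w, simplified]
  note r8 = exchange[OF L uu, of ?P \<I> "?X \<odot> w", simplified]
  note r9 = exchange[OF ibraid_hom[of u ?A] t, of ?P \<I> "?d \<odot> w", simplified]
  note r10 = exchange[OF ibraid_hom[of u ?A] braid_hom[of ?X ?d], of ?P \<I> w, simplified]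
  note r11 = exchange[OF coev_hom[of u] t, of "v\<^sup>\<star>" ?A "?d \<odot> w", simplified]
  note r12 = exchange[OF coev_hom[of u] braid_hom[of ?X ?d], of "v\<^sup>\<star>" ?A w, simplified]
  \<comment> \<open>At \<open>ev V u\<close> the inverse crossing of \<open>u\<close> with
    \<open>?A\<close> becomes \<open>\<beta> ?A ?d\<close>, which moves ahead of
    \<open>coev V u\<close> and lets the zig-zag close.\<close>
  note r13 = ibraid_ev[of ?P u ?A "?X \<odot> w", simplified]
  note r14 = exchange[OF coev_hom[of u] braid_hom[of ?A ?d], of "v\<^sup>\<star>" \<I> "?X \<odot> w", simplified]
  note z = zigzag_dual[of "v\<^sup>\<star>" u "?A \<odot> ?X \<odot> w", simplified]
  have rhs: "(f_hom (tensor_left V \<CC> x) b b' \<otimes> arr_inv V (\<Theta> x b' c)) \<Zsemi>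
     v_comp \<CC> (v_prod \<CC> x b) (v_prod \<CC> x b') c = ?nf"
    by (simp add: eqs arr_inv_eq[OF inverse_arrows_completion_theta] completion_tensor_left_hom
        dual_tensor ev_tensor ident_tensor_ident_whisk tensor_whisk
        comp_eq_assoc[OF r1] comp_eq_assoc[OF r2] comp_eq_assoc[OF r3] comp_eq_assoc[OF r4]
        comp_eq_assoc[OF r5] comp_eq_assoc[OF r6] comp_eq_assoc[OF r7] comp_eq_assoc[OF r8]
        comp_eq_assoc[OF r9] comp_eq_assoc[OF r10] comp_eq_assoc[OF r11] comp_eq_assoc[OF r12]
        comp_eq_assoc[OF r13] comp_eq_assoc[OF r14] comp_eq_assoc[OF z]
        del: completion_theta_whisk)
  show ?thesis
    unfolding lhs rhs ..
qed

lemma completion_theta_hom: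
  "\<Theta> x b c \<in> hom V (hom_obj \<CC> (v_prod \<CC> x b) c) (hom_obj \<CC> b (f_obj (\<HH> x) c))"
  by (cases x; cases b; cases c) (simp add: hom_def dual_tensor)

lemma completion_v_adjunction: "v_adjunction V \<CC> \<CC> (tensor_left V \<CC> x) (\<HH> x) (\<Theta> x)"
proof (intro v_adjunction.intro v_adjunction_axioms.intro completion_internal_hom_v_functor
    v_monoidal_category.tensor_left_v_functor completion_v_monoidal_category)
  have F: "f_obj (tensor_left V \<CC> x) b = v_prod \<CC> x b" for b
    by (simp add: tensor_left_def)
  show "\<Theta> x b c \<in> hom V (hom_obj \<CC> (f_obj (tensor_left V \<CC> x) b) c)
      (hom_obj \<CC> b (f_obj (\<HH> x) c))" for b c
    unfolding F by (rule completion_theta_hom)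
  show "is_iso V (\<Theta> x b c)" for b c
    unfolding is_iso_def by (cases x; cases b; cases c)
        (blast intro: inverse_arrows_completion_theta)
qed (simp_all add: completion_theta_natural_left completion_theta_natural_right tensor_left_def)

end

theorem proposition8p10:
  fixes V :: "('o, 'm) rigid_data" (structure)
    and C :: "('c, 'o, 'm) v_monoidal_data"
    and H :: "'c \<Rightarrow> ('c, 'c, 'm) v_functor_data"
    and \<theta> :: "'c \<Rightarrow> 'c \<Rightarrow> 'c \<Rightarrow> 'm"
  assumes "braided_rigid_category V"
    and "closed_v_monoidal_category V C"
    and "\<And>a. v_adjunction V C C (tensor_left V C a) (H a) (\<theta> a)"
  shows "(\<forall>a u.
           v_adjunction V (completion V C) (completion V C)
             (tensor_left V (completion V C) (a \<triangleleft> u))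
             (completion_internal_hom V C H (a \<triangleleft> u))
             (completion_theta V C \<theta> (a \<triangleleft> u)) \<and>
           (\<forall>b v c w.
             completion_theta V C \<theta> (a \<triangleleft> u) (b \<triangleleft> v) (c \<triangleleft> w)
               \<in> hom V (v\<^sup>\<star> \<odot> u\<^sup>\<star> \<odot> hom_obj C (v_prod C a b) c \<odot> w)
                       (v\<^sup>\<star> \<odot> hom_obj C b (f_obj (H a) c) \<odot> u\<^sup>\<star> \<odot> w) \<and>
             hom V (v\<^sup>\<star> \<odot> u\<^sup>\<star> \<odot> hom_obj C (v_prod C a b) c \<odot> w)
                   (v\<^sup>\<star> \<odot> hom_obj C b (f_obj (H a) c) \<odot> u\<^sup>\<star> \<odot> w) =
             hom V (hom_obj (completion V C)
                      (v_prod (completion V C) (a \<triangleleft> u) (b \<triangleleft> v)) (c \<triangleleft> w))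
                   (hom_obj (completion V C) (b \<triangleleft> v)
                      (f_obj (completion_internal_hom V C H (a \<triangleleft> u)) (c \<triangleleft> w)))))
       \<and> closed_v_monoidal_category V (completion V C)"
proof -
  interpret rigid_v_closed_category V C H \<theta>
    by (intro rigid_v_closed_category.intro rigid_v_monoidal_category.intro
        rigid_v_closed_category_axioms.intro assms closed_v_monoidal_category.axioms(1))
  \<comment> \<open>\<open>\<HH>\<close> and \<open>\<Theta>\<close> witness the existence that
    closedness demands.\<close>
  have "closed_v_monoidal_category V \<CC>"
    using completion_v_adjunction
    by (auto intro!: closed_v_monoidal_category.intro closed_v_monoidal_category_axioms.intro
        completion_v_monoidal_category)
  moreover have "\<Theta> (a \<triangleleft> u) (b \<triangleleft> v) (c \<triangleleft> w)
      \<in> hom V (v\<^sup>\<star> \<odot> u\<^sup>\<star> \<odot> hom_obj C (v_prod C a b) c \<odot> w)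
             (v\<^sup>\<star> \<odot> hom_obj C b (f_obj (H a) c) \<odot> u\<^sup>\<star> \<odot> w)" for a u b v c w
    by (simp add: hom_def)
  \<comment> \<open>\<open>dual_tensor\<close> rewrites the dual of \<open>u \<odot> v\<close>
    inside the hom objects of the completion, so the two descriptions of the hom set
    coincide.\<close>
  ultimately show ?thesis
    by (simp add: completion_v_adjunction dual_tensor del: completion_theta_whisk)
qed

end
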